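(* Let $n,d$ be integers with $2 \leq d \leq n-1$. Among all trees of order $n$ with diameter $d$, the minimum of the best meeting time $T_{\mathrm{bestmeet}}(G)$ is attained by the balanced lever $L_{n,d}$, and by no other tree (up to isomorphism). Moreover, $$ T_{\mathrm{bestmeet}}(L_{n,d}) = \begin{cases} \frac{d^3-d}{6(n-1)} + \frac{1}{2} & \text{if $d$ is odd,} \\ \frac{d^3-4d}{6(n-1)} + \frac{1}{2} & \text{if $d$ is even}. \\ \end{cases} $$
   Context: For a connected graph $G=(V,E)$, the simple random walk moves from a vertex $u$ to a uniformly random neighbor of $u$ at each step. The hitting time $H(u,v)$ is the expected number of steps for the walk started at $u$ to reach $v$, with $H(u,u)=0$. The stationary distribution is $\pi_v = \deg(v)/2|E|$. The meeting time at $v$ is $H(\pi,v)=\sum_{u\in V}\pi_u H(u,v)$, and the best meeting time of $G$ is $T_{\mathrm{bestmeet}}(G)=\min_{v\in V} H(\pi,v)$. A lever of order $n$ and diameter $d$ is a tree consisting of a path $v_0,v_1,\ldots,v_d$ together with $n-d-1$ additional leaves all adjacent to a single vertex $v_k$ of the path (the fulcrum), where $k$ is such that the resulting tree has diameter $d$. The balanced lever $L_{n,d}$ is the lever whose fulcrum is $v_{\lfloor d/2 \rfloor}$. *)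

theory Defs
  imports "HOL-Probability.Probability" "Graph_Theory.Graph_Theory"
begin

text \<open>
  A finite simple graph is a \<^term>\<open>pair_graph\<close>, i.e. a finite loop-free symmetric digraph in which
  each undirected edge is the pair of arcs \<open>(u, v)\<close> and \<open>(v, u)\<close>.
\<close>

definition edges :: "'a pair_pre_digraph \<Rightarrow> 'a set set" where
  "edges G = {{u, v} | u v. (u, v) \<in> parcs G}"

definition neighbors :: "'a pair_pre_digraph \<Rightarrow> 'a \<Rightarrow> 'a set" where
  "neighbors G u = {v. (u, v) \<in> parcs G}"

definition vertex_degree :: "'a pair_pre_digraph \<Rightarrow> 'a \<Rightarrow> nat" where
  "vertex_degree G u = card (neighbors G u)"

text \<open>
  In a symmetric digraph the arcs \<open>(u, v), (v, u)\<close> already form a \<open>cycle\<close> of length 2, so the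
  library's \<open>tree\<close> does not describe undirected trees. The cycles of the undirected graph are
  those of length at least 3.
\<close>

definition undirected_tree :: "'a pair_pre_digraph \<Rightarrow> bool" where
  "undirected_tree G \<longleftrightarrow>
     pair_graph G \<and> Digraph_Component.connected (with_proj G) \<and>
     \<not> (\<exists>p. pre_digraph.cycle (with_proj G) p \<and> 3 \<le> length p)"

text \<open>With unit weights \<open>wf_digraph.\<mu>\<close> is the graph distance.\<close>

definition graph_diameter :: "'a pair_pre_digraph \<Rightarrow> ereal" where
  "graph_diameter G =
     (SUP u \<in> pverts G. SUP v \<in> pverts G. wf_digraph.\<mu> (with_proj G) (\<lambda>_. 1) u v)"

text \<open>
  The law of the trajectory \<open>\<omega> 0, \<omega> 1, \<dots>\<close> of the simple random walk started at \<open>u\<close> is the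
  Ionescu-Tulcea measure whose \<open>i\<close>-th kernel gives the law of \<open>\<omega> i\<close> conditioned on
  \<open>\<omega> 0, \<dots>, \<omega> (i - 1)\<close>.
\<close>

fun srw_kernel :: "'a pair_pre_digraph \<Rightarrow> 'a \<Rightarrow> nat \<Rightarrow> (nat \<Rightarrow> 'a) \<Rightarrow> 'a measure" where
  "srw_kernel G u 0 \<omega> = measure_pmf (return_pmf u)"
| "srw_kernel G u (Suc i) \<omega> = measure_pmf (pmf_of_set (neighbors G (\<omega> i)))"

lemma Ionescu_Tulcea_srw: "Ionescu_Tulcea (srw_kernel G u) (\<lambda>_. count_space UNIV)"
proof (rule Ionescu_Tulcea.intro)
  fix i :: nat
  show "srw_kernel G u i
    \<in> Pi\<^sub>M {0..<i} (\<lambda>_. count_space UNIV) \<rightarrow>\<^sub>M subprob_algebra (count_space UNIV)"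
  proof (cases i)
    case 0
    have "srw_kernel G u i = (\<lambda>_. measure_pmf (return_pmf u))"
      by (simp add: 0 fun_eq_iff)
    then show ?thesis
      by (simp add: measure_pmf_in_subprob_algebra)
  next
    case (Suc j)
    have comp: "(\<lambda>\<omega>. \<omega> j) \<in> Pi\<^sub>M {0..<i} (\<lambda>_. count_space UNIV) \<rightarrow>\<^sub>M count_space (UNIV :: 'a set)"
      by (rule measurable_component_singleton) (simp add: Suc)
    have "(\<lambda>x. measure_pmf (pmf_of_set (neighbors G x)))
      \<in> count_space UNIV \<rightarrow>\<^sub>M subprob_algebra (count_space UNIV)"
      by (simp add: measure_pmf_in_subprob_algebra)
    from measurable_compose[OF comp this]
    have "(\<lambda>\<omega>. measure_pmf (pmf_of_set (neighbors G (\<omega> j))))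
      \<in> Pi\<^sub>M {0..<i} (\<lambda>_. count_space UNIV) \<rightarrow>\<^sub>M subprob_algebra (count_space UNIV)" .
    moreover have "srw_kernel G u i = (\<lambda>\<omega>. measure_pmf (pmf_of_set (neighbors G (\<omega> j))))"
      by (simp add: Suc fun_eq_iff)
    ultimately show ?thesis by simp
  qed
next
  show "prob_space (srw_kernel G u i \<omega>)" for i \<omega>
    by (cases i) (auto intro: prob_space_measure_pmf)
qed

definition srw :: "'a pair_pre_digraph \<Rightarrow> 'a \<Rightarrow> (nat \<Rightarrow> 'a) measure" where
  "srw G u =
     projective_family.lim UNIV
       (Ionescu_Tulcea.CI (srw_kernel G u) (\<lambda>_. count_space UNIV)) (\<lambda>_. count_space UNIV)"

definition first_hit :: "'a \<Rightarrow> (nat \<Rightarrow> 'a) \<Rightarrow> enat" where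
  "first_hit v \<omega> = (INF t \<in> {t. \<omega> t = v}. enat t)"

definition hitting_time :: "'a pair_pre_digraph \<Rightarrow> 'a \<Rightarrow> 'a \<Rightarrow> ennreal" where
  "hitting_time G u v = (\<integral>\<^sup>+ \<omega>. ennreal_of_enat (first_hit v \<omega>) \<partial>srw G u)"

definition stationary :: "'a pair_pre_digraph \<Rightarrow> 'a \<Rightarrow> real" where
  "stationary G v = real (vertex_degree G v) / (2 * real (card (edges G)))"

definition meeting_time :: "'a pair_pre_digraph \<Rightarrow> 'a \<Rightarrow> ennreal" where
  "meeting_time G v = (\<Sum>u\<in>pverts G. ennreal (stationary G u) * hitting_time G u v)"

definition best_meeting_time :: "'a pair_pre_digraph \<Rightarrow> ennreal" where
  "best_meeting_time G = Min (meeting_time G ` pverts G)"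

text \<open>
  \<open>lever n d k\<close> has the path \<open>0, 1, \<dots>, d\<close>, and the extra leaves \<open>d + 1, \<dots>, n - 1\<close>
  attached to the fulcrum \<open>k\<close>.
\<close>

definition lever :: "nat \<Rightarrow> nat \<Rightarrow> nat \<Rightarrow> nat pair_pre_digraph" where
  "lever n d k =
     (let A = {(i, i + 1) | i. i < d} \<union> {(k, j) | j. d < j \<and> j < n}
      in \<lparr>pverts = {..<n}, parcs = A \<union> A\<inverse>\<rparr>)"

definition balanced_lever :: "nat \<Rightarrow> nat \<Rightarrow> nat pair_pre_digraph" where
  "balanced_lever n d = lever n d (d div 2)"

end

theory Submission
  imports Defs
begin

text \<open>
  Root the tree at the target \<open>r\<close>. If \<open>s\<^sub>w\<close> is the size of the subtree below \<open>w \<noteq> r\<close>, the walk needs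
  \<open>a\<^sub>w = 2 s\<^sub>w - 1\<close> expected steps from \<open>w\<close> to its parent, and summation by parts gives
  \<open>H(\<pi>, r) = (\<Sum> a\<^sub>w\<^sup>2) / (2 (n - 1))\<close>. Every \<open>a\<^sub>w\<close> is at least 1. The two ends of a diametral path
  climb towards \<open>r\<close> along disjoint branches of lengths \<open>k\<close> and \<open>l\<close> with \<open>k + l \<ge> d\<close>, and on each of
  them the weights are at least \<open>1, 3, 5, \<dots>\<close>. The resulting lower bound is strictly convex in
  \<open>(k, l)\<close>, hence minimal exactly for the balanced split; equality of all weights forces the
  branches to end in \<open>r\<close> and every other vertex to be a leaf attached to \<open>r\<close>.
\<close>

section \<open>Hitting times of the random walk\<close>

text \<open>A hitting time is an \<open>ennreal\<close> expectation over infinite trajectories, and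
  the equation of first-step analysis is also solved by infinity. Finiteness therefore has to
  precede every subtraction; it comes from an explicit supersolution. Weights are then introduced by
  a recursion over children instead of by subtree sizes: differences of hitting times solve the
  recursion and the solution is unique, so for a concrete tree any explicit solution yields the
  meeting time.

  The bound concerns the sum of \<open>(a w)\<^sup>2 - 1\<close>. Subtracting 1 per vertex removes
  the dependence on \<open>n\<close>: the \<open>n - 1\<close> ones become the summand 1/2 of the
  formula, a leaf contributes nothing, and a bare branch of length \<open>k\<close> contributes
  \<open>4 * (k ^ 3 - k) / 3\<close>. The target \<open>r\<close> is arbitrary and may lie off the
  diametral path, so only \<open>d \<le> k + l\<close> is available; a chord of nonnegative slope
  compares all such pairs with the balanced one.\<close>

definition avoid_step :: "'a pair_pre_digraph \<Rightarrow> 'a \<Rightarrow> ('a \<Rightarrow> ennreal) \<Rightarrow> 'a \<Rightarrow> ennreal" where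
  "avoid_step G v f x =
     (\<integral>\<^sup>+ y. indicator (- {v}) y * f y \<partial>measure_pmf (pmf_of_set (neighbors G x)))"

context
  fixes G :: "'a pair_pre_digraph" and u v :: 'a
begin

interpretation W: Ionescu_Tulcea "srw_kernel G u" "\<lambda>_. count_space UNIV"
  by (rule Ionescu_Tulcea_srw)

lemma borel_measurable_avoid:
  "(\<lambda>\<omega>. (\<Prod>i\<le>t. indicator (- {v}) (\<omega> i)) * f (\<omega> t) :: ennreal)
    \<in> borel_measurable (PiM {0..<Suc t} (\<lambda>_. count_space (UNIV :: 'a set)))"
proof -
  have comp: "(\<lambda>\<omega>. g (\<omega> i)) \<in> borel_measurable (PiM {0..<Suc t} (\<lambda>_. count_space (UNIV :: 'a set)))"
    if "i \<le> t" for i and g :: "'a \<Rightarrow> ennreal"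
    by (rule measurable_compose[OF measurable_component_singleton]) (use that in auto)
  show ?thesis
    by (intro borel_measurable_times_ennreal borel_measurable_prod_ennreal comp) auto
qed

text \<open>
  The kernels extend a trajectory at its end. Iterating \<open>avoid_step\<close> turns this into a recursion in
  the starting vertex, so no Markov property of the infinite trajectory is needed.
\<close>

lemma nn_integral_C_avoid:
  "(\<integral>\<^sup>+ \<omega>. (\<Prod>i\<le>t. indicator (- {v}) (\<omega> i)) * f (\<omega> t) \<partial>W.C 0 (Suc t) (\<lambda>_. undefined))
     = indicator (- {v}) u * (avoid_step G v ^^ t) f u"
proof (induction t arbitrary: f)
  case 0
  have "W.C 0 (Suc 0) (\<lambda>_. undefined) = W.eP 0 (\<lambda>_. undefined)"
    by (simp add: bind_return[OF W.measurable_eP[of 0, simplified]] space_PiM)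
  then show ?case
    by (subst (1) \<open>W.C 0 (Suc 0) (\<lambda>_. undefined) = _\<close>, subst W.nn_integral_eP)
       (use borel_measurable_avoid[of 0 f] in \<open>auto simp: space_PiM nn_integral_return\<close>)
next
  case (Suc t)
  let ?M = "\<lambda>_::nat. count_space (UNIV :: 'a set)"
  have "(\<integral>\<^sup>+ \<omega>. (\<Prod>i\<le>Suc t. indicator (- {v}) (\<omega> i)) * f (\<omega> (Suc t)) \<partial>W.C 0 (Suc (Suc t)) (\<lambda>_. undefined))
    = (\<integral>\<^sup>+ \<omega>. (\<integral>\<^sup>+ \<omega>'. (\<Prod>i\<le>Suc t. indicator (- {v}) (\<omega>' i)) * f (\<omega>' (Suc t)) \<partial>W.eP (Suc t) \<omega>)
         \<partial>W.C 0 (Suc t) (\<lambda>_. undefined))"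
    unfolding W.C.simps(2)[of 0 "Suc t"]
    by (subst nn_integral_bind[where B = "PiM {0..<Suc (Suc t)} ?M"])
       (use borel_measurable_avoid[of "Suc t" f] W.measurable_eP[of "Suc t"] in
         \<open>auto simp del: W.C.simps simp: measurable_cong_sets[OF W.sets_C] space_PiM\<close>)
  also have "\<dots> = (\<integral>\<^sup>+ \<omega>. (\<Prod>i\<le>t. indicator (- {v}) (\<omega> i)) * avoid_step G v f (\<omega> t)
         \<partial>W.C 0 (Suc t) (\<lambda>_. undefined))"
  proof (rule nn_integral_cong)
    fix \<omega> assume "\<omega> \<in> space (W.C 0 (Suc t) (\<lambda>_. undefined))"
    then have \<omega>: "\<omega> \<in> space (PiM {0..<Suc t} ?M)"
      using W.space_C[of "\<lambda>_. undefined" 0 "Suc t"] by (simp add: space_PiM del: W.C.simps)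
    have "(\<integral>\<^sup>+ \<omega>'. (\<Prod>i\<le>Suc t. indicator (- {v}) (\<omega>' i)) * f (\<omega>' (Suc t)) \<partial>W.eP (Suc t) \<omega>)
      = (\<integral>\<^sup>+ x. (\<Prod>i\<le>t. indicator (- {v}) (\<omega> i)) * (indicator (- {v}) x * f x)
          \<partial>srw_kernel G u (Suc t) \<omega>)"
      by (subst W.nn_integral_eP[OF \<omega> borel_measurable_avoid])
         (auto intro!: nn_integral_cong simp: mult.assoc)
    also have "\<dots> = (\<Prod>i\<le>t. indicator (- {v}) (\<omega> i)) * avoid_step G v f (\<omega> t)"
      by (simp add: nn_integral_cmult avoid_step_def)
    finally show "(\<integral>\<^sup>+ \<omega>'. (\<Prod>i\<le>Suc t. indicator (- {v}) (\<omega>' i)) * f (\<omega>' (Suc t)) \<partial>W.eP (Suc t) \<omega>)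
      = (\<Prod>i\<le>t. indicator (- {v}) (\<omega> i)) * avoid_step G v f (\<omega> t)" .
  qed
  also have "\<dots> = indicator (- {v}) u * (avoid_step G v ^^ Suc t) f u"
    by (subst Suc.IH) (simp add: funpow_swap1)
  finally show ?case .
qed

text \<open>The event depends on coordinates \<open>0..t\<close> only, so it is a cylinder and its
  mass can be read off the finite composition of kernels. The right-hand side is the
  \<open>t\<close>-fold iterate of the transition operator killed at \<open>v\<close>.\<close>

lemma emeasure_srw_avoid:
  "emeasure (srw G u) {\<omega>. \<forall>i\<le>t. \<omega> i \<noteq> v} = indicator (- {v}) u * (avoid_step G v ^^ t) (\<lambda>_. 1) u"
proof -
  let ?M = "\<lambda>_::nat. count_space (UNIV :: 'a set)"
  define X where "X = {\<omega> \<in> space (PiM {0..<Suc t} ?M). \<forall>i\<le>t. \<omega> i \<noteq> v}"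
  have X: "X \<in> sets (PiM {0..<Suc t} ?M)"
  proof -
    have "X = PiE {0..<Suc t} (\<lambda>_. - {v})"
      by (auto simp: X_def space_PiM PiE_iff less_Suc_eq_le extensional_def)
    then show ?thesis by (auto intro!: sets_PiM_I_finite)
  qed
  have "{\<omega>. \<forall>i\<le>t. \<omega> i \<noteq> v} = W.PF.emb UNIV {0..<Suc t} X"
    by (auto simp: prod_emb_def X_def space_PiM)
  then have "emeasure (srw G u) {\<omega>. \<forall>i\<le>t. \<omega> i \<noteq> v} = W.CI {0..<Suc t} X"
    unfolding srw_def using W.lim[of "{0..<Suc t}" X] X by simp
  also have "\<dots> = W.C 0 (Suc t) (\<lambda>_. undefined) (W.PF.emb {0..<Suc t} {0..<Suc t} X)"
    by (rule W.emeasure_CI[OF _ X]) simp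
  also have "W.PF.emb {0..<Suc t} {0..<Suc t} X = X"
    by (rule prod_emb_id) (auto simp: X_def space_PiM)
  also have "W.C 0 (Suc t) (\<lambda>_. undefined) X
      = (\<integral>\<^sup>+ \<omega>. indicator X \<omega> \<partial>W.C 0 (Suc t) (\<lambda>_. undefined))"
    using X W.sets_C[of "\<lambda>_. undefined" 0 "Suc t"]
    by (subst nn_integral_indicator) (auto simp: space_PiM simp del: W.C.simps)
  also have "\<dots> = (\<integral>\<^sup>+ \<omega>. (\<Prod>i\<le>t. indicator (- {v}) (\<omega> i)) * 1 \<partial>W.C 0 (Suc t) (\<lambda>_. undefined))"
  proof (rule nn_integral_cong)
    fix \<omega> assume "\<omega> \<in> space (W.C 0 (Suc t) (\<lambda>_. undefined))"
    then have "\<omega> \<in> space (PiM {0..<Suc t} ?M)"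
      using W.space_C[of "\<lambda>_. undefined" 0 "Suc t"] by (simp add: space_PiM del: W.C.simps)
    then show "indicator X \<omega> = (\<Prod>i\<le>t. indicator (- {v}) (\<omega> i)) * (1 :: ennreal)"
      by (auto simp: X_def indicator_def prod_zero_iff intro!: prod.neutral)
  qed
  also have "\<dots> = indicator (- {v}) u * (avoid_step G v ^^ t) (\<lambda>_. 1) u"
    by (rule nn_integral_C_avoid)
  finally show ?thesis .
qed

lemma sets_srw: "sets (srw G u) = sets (PiM UNIV (\<lambda>_. count_space UNIV))"
  unfolding srw_def by (rule W.PF.sets_lim)

end

section \<open>Tail sums, first-step analysis and minimality of hitting times\<close>

lemma less_first_hit_iff: "enat t < first_hit v \<omega> \<longleftrightarrow> (\<forall>i\<le>t. \<omega> i \<noteq> v)"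
proof
  assume *: "enat t < first_hit v \<omega>"
  show "\<forall>i\<le>t. \<omega> i \<noteq> v"
  proof (intro allI impI notI)
    fix i assume "i \<le> t" "\<omega> i = v"
    then have "first_hit v \<omega> \<le> enat i"
      unfolding first_hit_def by (intro INF_lower) auto
    also have "\<dots> \<le> enat t" using \<open>i \<le> t\<close> by simp
    finally show False using * by simp
  qed
next
  assume "\<forall>i\<le>t. \<omega> i \<noteq> v"
  then have "enat (Suc t) \<le> first_hit v \<omega>"
    unfolding first_hit_def by (intro INF_greatest) (auto simp: not_less_eq_eq[symmetric])
  then show "enat t < first_hit v \<omega>"
    by (rule less_le_trans[rotated]) simp
qed

text \<open>This is the expectation of an \<open>enat\<close>-valued variable as the sum of the
  probabilities that it exceeds \<open>t\<close>.\<close>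

lemma hitting_time_eq_suminf:
  fixes u v :: "'a"
  shows
  "hitting_time G u v = (\<Sum>t. indicator (- {v}) u * (avoid_step G v ^^ t) (\<lambda>_. 1) u)"
proof -
  have space: "space (srw G u) = UNIV"
    using sets_eq_imp_space_eq[OF sets_srw[of G u]] by (simp add: space_PiM)
  have ms: "{\<omega>. \<forall>i\<le>t. \<omega> i \<noteq> v} \<in> sets (srw G u)" for t
  proof -
    have "{\<omega> \<in> space (PiM UNIV (\<lambda>_::nat. count_space UNIV)). \<forall>i\<in>{..t}. \<omega> i \<noteq> v}
      \<in> sets (PiM UNIV (\<lambda>_::nat. count_space UNIV))"
      by measurable
    then show ?thesis by (simp add: sets_srw space_PiM Ball_def)
  qed
  \<comment> \<open>The index set in \<open>first_hit_def\<close> depends on the trajectory. Taking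
    the infimum over all times, with the default \<open>\<top>\<close> at times off
    \<open>v\<close>, gives a countable infimum of measurable functions.\<close>
  have "first_hit v = (\<lambda>\<omega> :: nat \<Rightarrow> 'a. INF t. if \<omega> t = v then enat t else \<top>)"
  proof (intro ext antisym)
    fix \<omega> :: "nat \<Rightarrow> 'a"
    have "first_hit v \<omega> \<le> enat t" if "\<omega> t = v" for t
      unfolding first_hit_def using that by (intro INF_lower) simp
    then show "first_hit v \<omega> \<le> (INF t. if \<omega> t = v then enat t else \<top>)"
      by (intro INF_greatest) simp
    have "(INF t. if \<omega> t = v then enat t else \<top>) \<le> enat t" if "\<omega> t = v" for t
      using that by (intro INF_lower2[of t]) simp_all
    then show "(INF t. if \<omega> t = v then enat t else \<top>) \<le> first_hit v \<omega>"
      unfolding first_hit_def by (intro INF_greatest) simp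
  qed
  also have "\<dots> \<in> measurable (PiM UNIV (\<lambda>_. count_space UNIV)) (count_space UNIV)"
    by measurable
  finally have "first_hit v \<in> measurable (srw G u) (count_space UNIV)"
    by (simp add: measurable_cong_sets[OF sets_srw refl])
  then show ?thesis
    unfolding hitting_time_def
    by (simp add: nn_integral_enat_function space less_first_hit_iff emeasure_srw_avoid)
qed

lemma hitting_time_self: "hitting_time G v v = 0"
  by (simp add: hitting_time_eq_suminf)

text \<open>First-step analysis, obtained by splitting off the term \<open>t = 0\<close> of the tail
  sum. The identity lives in \<open>ennreal\<close> and does not presuppose finiteness.\<close>

lemma hitting_time_step:
  assumes "u \<noteq> v" and "finite (neighbors G u)" and "neighbors G u \<noteq> {}"
  shows "hitting_time G u v
    = 1 + (\<Sum>w\<in>neighbors G u. hitting_time G w v) / card (neighbors G u)"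
proof -
  \<comment> \<open>\<open>q t w\<close> is the probability that the walk from \<open>w\<close> has
    not met \<open>v\<close> up to time \<open>t\<close>.\<close>
  define q where "q t w = indicator (- {v}) w * (avoid_step G v ^^ t) (\<lambda>_. 1) w" for t w
  have q_Suc: "q (Suc t) u = (\<integral>\<^sup>+ w. q t w \<partial>measure_pmf (pmf_of_set (neighbors G u)))" for t
    using assms(1) by (simp add: q_def avoid_step_def)
  have "hitting_time G u v = (\<Sum>t. q t u)"
    by (simp add: hitting_time_eq_suminf q_def)
  also have "\<dots> = q 0 u + (\<Sum>t. q (Suc t) u)"
    using suminf_offset[of "\<lambda>t. q t u" 1] by simp
  also have "(\<Sum>t. q (Suc t) u) = (\<integral>\<^sup>+ w. (\<Sum>t. q t w) \<partial>measure_pmf (pmf_of_set (neighbors G u)))"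
    by (simp add: q_Suc nn_integral_suminf)
  also have "\<dots> = (\<Sum>w\<in>neighbors G u. \<Sum>t. q t w) / card (neighbors G u)"
    by (rule nn_integral_pmf_of_set) fact+
  also have "q 0 u = 1" using assms(1) by (simp add: q_def)
  finally show ?thesis by (simp add: hitting_time_eq_suminf q_def)
qed

text \<open>Hitting times are the least nonnegative solution of the first-step equation: by
  induction on \<open>T\<close>, the tail sum truncated at \<open>T\<close> stays below every
  supersolution. This is what excludes the infinite solution.\<close>

lemma hitting_time_le_supersolution:
  fixes g :: "'a \<Rightarrow> ennreal"
  assumes nb: "\<And>w. w \<in> S \<Longrightarrow> w \<noteq> v \<Longrightarrow>
      finite (neighbors G w) \<and> neighbors G w \<noteq> {} \<and> neighbors G w \<subseteq> S"
    and super: "\<And>w. w \<in> S \<Longrightarrow> w \<noteq> v \<Longrightarrow>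
      1 + (\<Sum>x\<in>neighbors G w. g x) / card (neighbors G w) \<le> g w"
    and "u \<in> S"
  shows "hitting_time G u v \<le> g u"
proof -
  define q where "q t w = indicator (- {v}) w * (avoid_step G v ^^ t) (\<lambda>_. 1) w" for t w
  have "(\<Sum>t<T. q t w) \<le> g w" if "w \<in> S" for T w
    using that
  proof (induction T arbitrary: w)
    case (Suc T)
    show ?case
    proof (cases "w = v")
      case True then show ?thesis by (simp add: q_def)
    next
      case False
      let ?N = "neighbors G w"
      have q_Suc: "q (Suc t) w = (\<integral>\<^sup>+ x. q t x \<partial>measure_pmf (pmf_of_set ?N))" for t
        using False by (simp add: q_def avoid_step_def)
      have "(\<Sum>t<Suc T. q t w) = 1 + (\<integral>\<^sup>+ x. (\<Sum>t<T. q t x) \<partial>measure_pmf (pmf_of_set ?N))"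
        using False by (simp add: sum.lessThan_Suc_shift q_Suc nn_integral_sum del: sum.lessThan_Suc)
          (simp add: q_def)
      also have "\<dots> = 1 + (\<Sum>x\<in>?N. \<Sum>t<T. q t x) / card ?N"
        by (subst nn_integral_pmf_of_set) (use nb[OF Suc.prems False] in auto)
      also have "\<dots> \<le> 1 + (\<Sum>x\<in>?N. g x) / card ?N"
        using nb[OF Suc.prems False]
        by (intro add_left_mono divide_right_mono_ennreal sum_mono Suc.IH) auto
      also have "\<dots> \<le> g w" by (rule super[OF Suc.prems False])
      finally show ?thesis .
    qed
  qed simp
  then have "(\<Sum>t. q t u) \<le> g u"
    using \<open>u \<in> S\<close> by (intro suminf_le_const summableI)
  then show ?thesis by (simp add: hitting_time_eq_suminf q_def)
qed

section \<open>Hitting times in rooted trees\<close>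

text \<open>Every edge joins a non-root vertex to its parent, and \<open>depth\<close> counts the
  parent steps to \<open>r\<close>. Acyclicity is thus encoded by a rank, which makes induction
  along parents and children immediate.\<close>

locale rooted_tree =
  fixes G :: "'a pair_pre_digraph" and r :: 'a and par :: "'a \<Rightarrow> 'a" and depth :: "'a \<Rightarrow> nat"
  assumes finite_verts: "finite (pverts G)"
    and root_in: "r \<in> pverts G"
    and par_in: "w \<in> pverts G - {r} \<Longrightarrow> par w \<in> pverts G"
    and depth_root: "depth r = 0"
    and depth_par: "w \<in> pverts G - {r} \<Longrightarrow> depth w = Suc (depth (par w))"
    and arcs_eq: "parcs G = {(w, par w) | w. w \<in> pverts G - {r}} \<union> {(par w, w) | w. w \<in> pverts G - {r}}"
begin

definition children :: "'a \<Rightarrow> 'a set" where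
  "children u = {w \<in> pverts G - {r}. par w = u}"

lemma finite_children: "finite (children u)"
  using finite_verts by (simp add: children_def)

lemma childrenD: "c \<in> children u \<Longrightarrow> c \<in> pverts G - {r}" "c \<in> children u \<Longrightarrow> par c = u"
  by (auto simp: children_def)

lemma par_notin_children: "w \<in> pverts G - {r} \<Longrightarrow> par w \<notin> children w"
  using depth_par[of w] depth_par[of "par w"] by (auto simp: children_def)

lemma neighbors_nonroot: "w \<in> pverts G - {r} \<Longrightarrow> neighbors G w = insert (par w) (children w)"
  unfolding neighbors_def children_def arcs_eq by auto

lemma neighbors_subset: "u \<in> pverts G \<Longrightarrow> neighbors G u \<subseteq> pverts G"
  unfolding neighbors_def arcs_eq by (auto intro: par_in)

lemma vertex_degree_nonroot:
  "w \<in> pverts G - {r} \<Longrightarrow> vertex_degree G w = Suc (card (children w))"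
  by (simp add: vertex_degree_def neighbors_nonroot par_notin_children finite_children)

lemma sum_neighbors:
  fixes f :: "'a \<Rightarrow> 'b :: comm_monoid_add"
  assumes "w \<in> pverts G - {r}"
  shows "(\<Sum>x\<in>neighbors G w. f x) = f (par w) + (\<Sum>c\<in>children w. f c)"
  using assms by (simp add: neighbors_nonroot par_notin_children finite_children)

lemma sum_children:
  fixes f :: "'a \<Rightarrow> 'b :: comm_monoid_add"
  shows "(\<Sum>u\<in>pverts G. \<Sum>c\<in>children u. f c) = (\<Sum>c\<in>pverts G - {r}. f c)"
  unfolding children_def
  by (rule sum.group) (use finite_verts par_in in auto)

lemma card_edges: "card (edges G) = card (pverts G) - 1"
proof -
  have "edges G = (\<lambda>w. {w, par w}) ` (pverts G - {r})"
    unfolding edges_def arcs_eq by (auto simp: insert_commute)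
  moreover have "inj_on (\<lambda>w. {w, par w}) (pverts G - {r})"
  proof (rule inj_onI)
    \<comment> \<open>The crossed case \<open>w = par x\<close>, \<open>x = par w\<close>
      contradicts the depths.\<close>
    fix w x assume wx: "w \<in> pverts G - {r}" "x \<in> pverts G - {r}" "{w, par w} = {x, par x}"
    then show "w = x"
      using depth_par[of w] depth_par[of x] by (auto simp: doubleton_eq_iff)
  qed
  ultimately have "card (edges G) = card (pverts G - {r})"
    by (simp add: card_image)
  then show ?thesis
    using root_in by simp
qed

text \<open>Induction from the leaves towards the root; the measure is the gap between
  \<open>depth w\<close> and the maximal depth, which shrinks on passing to a child.\<close>

lemma leaf_induct [consumes 1, case_names step]:
  assumes "w \<in> pverts G - {r}"
    and step: "\<And>w. w \<in> pverts G - {r} \<Longrightarrow> (\<And>c. c \<in> children w \<Longrightarrow> P c) \<Longrightarrow> P w"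
  shows "P w"
  using assms(1)
proof (induction "Max (depth ` pverts G) - depth w" arbitrary: w rule: less_induct)
  case less
  show ?case
  proof (rule step[OF less.prems])
    fix c assume c: "c \<in> children w"
    have "depth c \<le> Max (depth ` pverts G)"
      using finite_verts childrenD(1)[OF c] by (intro Max_ge) auto
    moreover have "depth c = Suc (depth w)"
      using depth_par childrenD[OF c] by auto
    ultimately show "P c"
      using childrenD(1)[OF c] by (intro less.hyps) auto
  qed
qed

text \<open>
  For a subtree with \<open>s\<close> vertices hanging from \<open>w\<close>, the weight of \<open>w\<close> is \<open>2 * s - 1\<close>, the expected
  time the walk needs from \<open>w\<close> to \<open>par w\<close>.
\<close>

definition weights :: "('a \<Rightarrow> real) \<Rightarrow> bool" where
  "weights a \<longleftrightarrow> (\<forall>w \<in> pverts G - {r}. a w = 1 + (\<Sum>c\<in>children w. a c + 1))"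

lemma weightsD: "weights a \<Longrightarrow> w \<in> pverts G - {r} \<Longrightarrow> a w = 1 + (\<Sum>c\<in>children w. a c + 1)"
  by (auto simp: weights_def)

lemma weights_ge_1: "weights a \<Longrightarrow> w \<in> pverts G - {r} \<Longrightarrow> 1 \<le> a w"
proof (rotate_tac, induction w rule: leaf_induct)
  case (step w)
  have "0 \<le> (\<Sum>c\<in>children w. a c + 1)"
    using step by (intro sum_nonneg) (auto intro: add_nonneg_nonneg order_trans[OF zero_le_one])
  then show ?case using weightsD[OF step(3,1)] by simp
qed

text \<open>Uniqueness identifies an arbitrary solution of the recursion with the differences of
  hitting times, so the meeting-time formula can be evaluated on explicit weights.\<close>

lemma weights_unique:
  assumes "weights a" "weights b" "w \<in> pverts G - {r}"
  shows "a w = b w"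
  using assms(3)
proof (induction w rule: leaf_induct)
  case (step w)
  then show ?case
    using weightsD[OF assms(1) step(1)] weightsD[OF assms(2) step(1)] by simp
qed

lemma finite_neighbors: "finite (neighbors G w)"
  by (rule finite_subset[of _ "pverts G"])
     (auto simp: neighbors_def arcs_eq finite_verts intro: par_in)

lemma hitting_time_finite:
  assumes "u \<in> pverts G"
  shows "hitting_time G u r < \<top>"
proof -
  define n where "n = real (card (pverts G))"
  define N where "N = Max (depth ` pverts G)"
  \<comment> \<open>The supersolution depends on the depth only. Its increments \<open>b\<close>
    shrink by the factor \<open>n + 1\<close> per level away from the root, so the drop towards the
    parent outweighs the rise towards all children plus the unit cost of each step. The exponent
    \<open>N + 1 - i\<close> keeps \<open>b\<close> at least \<open>n + 1\<close> down to the
    maximal depth \<open>N\<close>.\<close>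
  define b where "b i = (n + 1) ^ (N + 1 - i)" for i
  define g where "g w = (\<Sum>i<depth w. b i)" for w
  have n: "0 \<le> n" by (simp add: n_def)
  have b: "0 \<le> b i" for i using n by (simp add: b_def)
  have g: "0 \<le> g w" for w using b by (simp add: g_def sum_nonneg)
  have "hitting_time G u r \<le> ennreal (g u)"
  proof (rule hitting_time_le_supersolution[where S = "pverts G" and g = "\<lambda>x. ennreal (g x)"])
    fix w assume w: "w \<in> pverts G" "w \<noteq> r"
    then show "finite (neighbors G w) \<and> neighbors G w \<noteq> {} \<and> neighbors G w \<subseteq> pverts G"
      using finite_neighbors[of w] neighbors_subset[of w] neighbors_nonroot[of w] by blast
    define k where "k = real (card (neighbors G w))"
    have k_eq: "k = 1 + real (card (children w))"
      using vertex_degree_nonroot w by (simp add: k_def vertex_degree_def)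
    have kn: "k \<le> n"
      unfolding k_def n_def using card_mono[OF finite_verts neighbors_subset[OF w(1)]] by simp
    have d: "depth w = Suc (depth (par w))" using depth_par w by simp
    have dN: "depth w \<le> N" unfolding N_def using finite_verts w by (intro Max_ge) auto
    have g_par: "g w = g (par w) + b (depth (par w))"
      using d by (simp add: g_def)
    have g_child: "g c = g w + b (depth w)" if "c \<in> children w" for c
      using depth_par[of c] childrenD[OF that] by (simp add: g_def)
    have "N + 1 - depth (par w) = Suc (N + 1 - depth w)" using d dN by simp
    then have b_step: "b (depth (par w)) = (n + 1) * b (depth w)"
      by (simp add: b_def)
    have "1 \<le> (n + 1) ^ (N - depth w)" using n by (intro one_le_power) simp
    then have "n + 1 \<le> b (depth w)"
      using dN n by (simp add: b_def Suc_diff_le mult_left_mono[of 1 _ "n + 1"] del: mult_1_right)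
    moreover have "(k - 1) * b (depth w) \<le> n * b (depth w)"
      using kn b by (intro mult_right_mono) auto
    ultimately have key: "k + (k - 1) * b (depth w) \<le> b (depth (par w))"
      using kn unfolding b_step by (simp add: algebra_simps)
    have "(\<Sum>x\<in>neighbors G w. g x) = g w - b (depth (par w)) + (k - 1) * (g w + b (depth w))"
      using w g_par by (simp add: sum_neighbors g_child k_eq)
    then have "(\<Sum>x\<in>neighbors G w. g x) \<le> k * (g w - 1)"
      using key by (simp add: algebra_simps)
    then have "1 + (\<Sum>x\<in>neighbors G w. g x) / k \<le> g w"
      using k_eq by (simp add: field_simps)
    moreover have "1 + (\<Sum>x\<in>neighbors G w. ennreal (g x)) / card (neighbors G w)
      = ennreal (1 + (\<Sum>x\<in>neighbors G w. g x) / k)"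
      using k_eq g by (simp add: sum_nonneg divide_ennreal k_def ennreal_of_nat_eq_real_of_nat flip: ennreal_1 ennreal_plus)
    ultimately show "1 + (\<Sum>x\<in>neighbors G w. ennreal (g x)) / card (neighbors G w) \<le> ennreal (g w)"
      by (simp add: ennreal_leI)
  qed fact
  then show ?thesis by (rule le_less_trans) simp
qed

lemma enn2real_hitting_time_step:
  assumes "w \<in> pverts G - {r}"
  shows "real (card (neighbors G w)) * (enn2real (hitting_time G w r) - 1)
    = (\<Sum>x\<in>neighbors G w. enn2real (hitting_time G x r))"
proof -
  define H where "H u = enn2real (hitting_time G u r)" for u
  have H: "hitting_time G u r = ennreal (H u)" if "u \<in> pverts G" for u
    using hitting_time_finite[OF that] by (simp add: H_def)
  have Hn: "0 \<le> H u" for u by (simp add: H_def)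
  let ?N = "neighbors G w"
  have N: "finite ?N" "?N \<noteq> {}" "?N \<subseteq> pverts G"
    using assms finite_neighbors[of w] neighbors_nonroot[of w] neighbors_subset[of w] by blast+
  then have pos: "0 < real (card ?N)" by (simp add: card_gt_0_iff)
  have "ennreal (H w) = 1 + (\<Sum>x\<in>?N. hitting_time G x r) / card ?N"
    using hitting_time_step[of w r G] assms N H[of w] by simp
  also have "(\<Sum>x\<in>?N. hitting_time G x r) = (\<Sum>x\<in>?N. ennreal (H x))"
    using N(3) H by (intro sum.cong) auto
  also have "\<dots> = ennreal (\<Sum>x\<in>?N. H x)"
    using Hn by (rule sum_ennreal)
  also have "1 + ennreal (\<Sum>x\<in>?N. H x) / card ?N = ennreal (1 + (\<Sum>x\<in>?N. H x) / card ?N)"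
    using Hn pos
    by (simp add: sum_nonneg divide_ennreal ennreal_of_nat_eq_real_of_nat flip: ennreal_1 ennreal_plus)
  finally have "H w = 1 + (\<Sum>x\<in>?N. H x) / card ?N"
    by (subst (asm) ennreal_inj) (auto intro!: add_nonneg_nonneg divide_nonneg_nonneg sum_nonneg Hn)
  then show ?thesis using pos by (simp add: H_def field_simps)
qed

text \<open>Multiplying the first-step equation by the degree, one parent plus the children, and
  regrouping gives the recursion for the increments of the hitting time. It also provides the
  existence of weights on every rooted tree.\<close>

lemma weights_hitting_time:
  "weights (\<lambda>w. enn2real (hitting_time G w r) - enn2real (hitting_time G (par w) r))"
  unfolding weights_def
proof
  fix w assume w: "w \<in> pverts G - {r}"
  define H where "H u = enn2real (hitting_time G u r)" for u
  have "(1 + real (card (children w))) * (H w - 1) = H (par w) + (\<Sum>c\<in>children w. H c)"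
    using enn2real_hitting_time_step[OF w] vertex_degree_nonroot[OF w]
    by (simp add: sum_neighbors[OF w] vertex_degree_def H_def)
  moreover have "(\<Sum>c\<in>children w. H c - H (par c) + 1)
      = (\<Sum>c\<in>children w. H c) - real (card (children w)) * (H w - 1)"
    by (simp add: sum.distrib sum_subtractf childrenD(2) algebra_simps)
  ultimately have "H w - H (par w) = 1 + (\<Sum>c\<in>children w. H c - H (par c) + 1)"
    by (simp add: algebra_simps)
  then show "enn2real (hitting_time G w r) - enn2real (hitting_time G (par w) r) =
    1 + (\<Sum>c\<in>children w. enn2real (hitting_time G c r) - enn2real (hitting_time G (par c) r) + 1)"
    by (simp add: H_def)
qed

lemma meeting_time_eq_sum_weights:
  assumes a: "weights a"
  shows "meeting_time G r
    = ennreal ((\<Sum>w\<in>pverts G - {r}. (a w)\<^sup>2) / (2 * (real (card (pverts G)) - 1)))"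
proof -
  let ?S = "pverts G - {r}"
  define H where "H u = enn2real (hitting_time G u r)" for u
  have H: "hitting_time G u r = ennreal (H u)" if "u \<in> pverts G" for u
    using hitting_time_finite[OF that] by (simp add: H_def)
  have Hn: "0 \<le> H u" for u by (simp add: H_def)
  have Hr: "H r = 0" by (simp add: H_def hitting_time_self)
  have Hw: "H w = H (par w) + a w" if "w \<in> ?S" for w
    using weights_unique[OF a weights_hitting_time that] by (simp add: H_def)
  have split: "(\<Sum>w\<in>pverts G. f w) = f r + (\<Sum>w\<in>?S. f w)" for f :: "'a \<Rightarrow> real"
    using sum.remove[OF finite_verts root_in] .

  \<comment> \<open>Summation by parts: weight the recursion for \<open>a\<close> by \<open>H\<close> and sum over all vertices.\<close>
  have "(\<Sum>w\<in>?S. H w * a w) = (\<Sum>w\<in>?S. H w * (1 + (\<Sum>c\<in>children w. a c + 1)))"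
    using weightsD[OF a] by (intro sum.cong) auto
  also have "\<dots> = (\<Sum>w\<in>?S. H w) + (\<Sum>w\<in>?S. \<Sum>c\<in>children w. H (par c) * (a c + 1))"
    by (simp add: distrib_left sum.distrib sum_distrib_left childrenD(2) mult.commute)
  \<comment> \<open>Children of the root are missing on the left; on the right their terms vanish
    because \<open>H r = 0\<close>.\<close>
  also have "(\<Sum>w\<in>?S. \<Sum>c\<in>children w. H (par c) * (a c + 1)) = (\<Sum>c\<in>?S. H (par c) * (a c + 1))"
    using sum_children[of "\<lambda>c. H (par c) * (a c + 1)"]
      split[of "\<lambda>w. \<Sum>c\<in>children w. H (par c) * (a c + 1)"]
    by (simp add: childrenD(2) Hr)
  finally have "(\<Sum>w\<in>?S. H w * a w - H w - H (par w) * (a w + 1)) = 0"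
    by (simp add: sum_subtractf)
  moreover have "(\<Sum>w\<in>?S. H w * a w - H w - H (par w) * (a w + 1))
      = (\<Sum>w\<in>?S. (a w)\<^sup>2 - (H w + H (par w)))"
    by (intro sum.cong) (auto simp: Hw algebra_simps power2_eq_square)
  ultimately have squares: "(\<Sum>w\<in>?S. (a w)\<^sup>2) = (\<Sum>w\<in>?S. H w + H (par w))"
    by (simp add: sum_subtractf)

  \<comment> \<open>Counting by edges: the degree-weighted sum of \<open>H\<close> is the sum of
    \<open>H w + H (par w)\<close> over all edges, which is the right-hand side of
    \<open>squares\<close>.\<close>
  have "(\<Sum>u\<in>pverts G. real (vertex_degree G u) * H u)
      = (\<Sum>w\<in>?S. H w) + (\<Sum>u\<in>pverts G. real (card (children u)) * H u)"
    by (simp add: split vertex_degree_nonroot Hr distrib_right sum.distrib)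
  also have "(\<Sum>u\<in>pverts G. real (card (children u)) * H u)
      = (\<Sum>u\<in>pverts G. \<Sum>c\<in>children u. H (par c))"
    by (simp add: childrenD(2))
  also have "\<dots> = (\<Sum>w\<in>?S. H (par w))" by (rule sum_children)
  finally have degree_sum: "(\<Sum>u\<in>pverts G. real (vertex_degree G u) * H u) = (\<Sum>w\<in>?S. (a w)\<^sup>2)"
    by (simp add: squares sum.distrib)

  have "1 \<le> card (pverts G)"
    using finite_verts root_in by (auto simp: Suc_le_eq card_gt_0_iff)
  then have m: "real (card (edges G)) = real (card (pverts G)) - 1"
    by (simp add: card_edges)
  have stat: "0 \<le> stationary G u" for u by (simp add: stationary_def)
  have "meeting_time G r = (\<Sum>u\<in>pverts G. ennreal (stationary G u * H u))"
    unfolding meeting_time_def using Hn stat by (intro sum.cong) (auto simp: H ennreal_mult)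
  also have "\<dots> = ennreal (\<Sum>u\<in>pverts G. stationary G u * H u)"
    using Hn stat by (intro sum_ennreal) simp
  also have "(\<Sum>u\<in>pverts G. stationary G u * H u)
      = (\<Sum>u\<in>pverts G. real (vertex_degree G u) * H u) / (2 * (real (card (pverts G)) - 1))"
    by (simp add: stationary_def sum_divide_distrib m)
  finally show ?thesis by (simp add: degree_sum)
qed

end

section \<open>Undirected trees as rooted trees\<close>

text \<open>Walks of length \<open>k\<close> are handled as relation powers; this translates between
  them and the arc lists behind \<open>awalk\<close>, and hence the distance and the cycles.\<close>

lemma relpow_iff_pcas:
  "(u, v) \<in> R ^^ k \<longleftrightarrow> (\<exists>p. set p \<subseteq> R \<and> pcas u p v \<and> length p = k)"
proof (induction k arbitrary: u)
  case (Suc k)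
  show ?case
  proof
    assume "(u, v) \<in> R ^^ Suc k"
    then obtain w where "(u, w) \<in> R" "(w, v) \<in> R ^^ k" by (blast dest: relpow_Suc_D2)
    then obtain p where "set p \<subseteq> R" "pcas w p v" "length p = k" using Suc.IH by blast
    with \<open>(u, w) \<in> R\<close> show "\<exists>p. set p \<subseteq> R \<and> pcas u p v \<and> length p = Suc k"
      by (intro exI[of _ "(u, w) # p"]) simp
  next
    assume "\<exists>p. set p \<subseteq> R \<and> pcas u p v \<and> length p = Suc k"
    then obtain e p where "e \<in> R" "fst e = u" "set p \<subseteq> R" "pcas (snd e) p v" "length p = k"
      by (auto simp: length_Suc_conv)
    then show "(u, v) \<in> R ^^ Suc k"
      using Suc.IH by (intro relpow_Suc_I2[of u "snd e"]) auto
  qed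
qed auto

lemma awalk_with_proj_iff:
  "pre_digraph.awalk (with_proj G) u p v \<longleftrightarrow> u \<in> pverts G \<and> set p \<subseteq> parcs G \<and> pcas u p v"
  by (simp add: pre_digraph.awalk_def cas_with_proj_eq)

lemma \<mu>_le_relpow:
  assumes "pair_wf_digraph G" "u \<in> pverts G" "(u, v) \<in> parcs G ^^ k"
  shows "wf_digraph.\<mu> (with_proj G) (\<lambda>_. 1) u v \<le> ereal (real k)"
proof -
  interpret wf_digraph "with_proj G" using assms(1) by (simp add: wf_digraph_wp_iff)
  obtain p where p: "awalk u p v" "length p = k"
    using assms(2,3) by (auto simp: relpow_iff_pcas awalk_with_proj_iff)
  then show ?thesis
    using min_cost_le_walk_cost[OF p(1), of "\<lambda>_. 1"] by (simp add: awalk_cost_def sum_list_triv)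
qed

lemma le_\<mu>_relpow:
  assumes "pair_wf_digraph G" "\<And>k. (u, v) \<in> parcs G ^^ k \<Longrightarrow> d \<le> k"
  shows "ereal (real d) \<le> wf_digraph.\<mu> (with_proj G) (\<lambda>_. 1) u v"
proof -
  interpret wf_digraph "with_proj G" using assms(1) by (simp add: wf_digraph_wp_iff)
  have "d \<le> length p" if "awalk u p v" for p
    using that assms(2) by (auto simp: relpow_iff_pcas awalk_with_proj_iff)
  then show ?thesis
    unfolding \<mu>_def by (intro INF_greatest) (auto simp: awalk_cost_def sum_list_triv)
qed

text \<open>Walk lengths are integers: if every pair were joined by a walk shorter than
  \<open>d\<close>, the supremum would be at most \<open>d - 1\<close>.\<close>

lemma far_pair_of_graph_diameter:
  assumes "pair_wf_digraph G" "graph_diameter G = ereal (real d)" "0 < d"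
  obtains u v where "u \<in> pverts G" "v \<in> pverts G" "\<And>k. (u, v) \<in> parcs G ^^ k \<Longrightarrow> d \<le> k"
proof (rule ccontr)
  assume "\<not> thesis"
  with that have near: "\<exists>k<d. (u, v) \<in> parcs G ^^ k" if "u \<in> pverts G" "v \<in> pverts G" for u v
    using that not_le by blast
  have "graph_diameter G \<le> ereal (real (d - 1))"
    unfolding graph_diameter_def
  proof (intro SUP_least)
    fix u v assume uv: "u \<in> pverts G" "v \<in> pverts G"
    then obtain k where k: "k < d" "(u, v) \<in> parcs G ^^ k" using near by blast
    have "wf_digraph.\<mu> (with_proj G) (\<lambda>_. 1) u v \<le> ereal (real k)"
      by (rule \<mu>_le_relpow) fact+
    also have "\<dots> \<le> ereal (real (d - 1))" using k by simp
    finally show "wf_digraph.\<mu> (with_proj G) (\<lambda>_. 1) u v \<le> ereal (real (d - 1))" .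
  qed
  then show False using assms(2,3) by simp
qed

lemma graph_diameter_eqI:
  assumes "pair_wf_digraph G" "u \<in> pverts G" "v \<in> pverts G"
    and "\<And>k. (u, v) \<in> parcs G ^^ k \<Longrightarrow> d \<le> k"
    and "\<And>x y. x \<in> pverts G \<Longrightarrow> y \<in> pverts G \<Longrightarrow> \<exists>k\<le>d. (x, y) \<in> parcs G ^^ k"
  shows "graph_diameter G = ereal (real d)"
proof (rule antisym)
  show "graph_diameter G \<le> ereal (real d)"
    unfolding graph_diameter_def
  proof (intro SUP_least)
    fix x y assume xy: "x \<in> pverts G" "y \<in> pverts G"
    then obtain k where k: "k \<le> d" "(x, y) \<in> parcs G ^^ k" using assms(5) by blast
    have "wf_digraph.\<mu> (with_proj G) (\<lambda>_. 1) x y \<le> ereal (real k)"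
      by (rule \<mu>_le_relpow) fact+
    also have "\<dots> \<le> ereal (real d)" using k by simp
    finally show "wf_digraph.\<mu> (with_proj G) (\<lambda>_. 1) x y \<le> ereal (real d)" .
  qed
  have "ereal (real d) \<le> wf_digraph.\<mu> (with_proj G) (\<lambda>_. 1) u v"
    by (rule le_\<mu>_relpow) fact+
  then show "ereal (real d) \<le> graph_diameter G"
    unfolding graph_diameter_def using assms(2,3) by (intro SUP_upper2[of u] SUP_upper2[of v])
qed

lemma pair_graph_arcs_symmetric:
  "pair_graph G \<Longrightarrow> (u, v) \<in> parcs G \<Longrightarrow> (v, u) \<in> parcs G"
  using pair_sym_digraph.arcs_symmetric[of G u v]
  by (simp add: pair_graph_def pair_pseudo_graph_def)

text \<open>Otherwise a simple path from \<open>x\<close> to \<open>u\<close> avoiding this edge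
  would close up with the arc \<open>(u, x)\<close> to a forbidden cycle. Both orientations are
  deleted so that the path cannot be the reversed arc alone, which would give only a cycle of length
  2.\<close>

lemma undirected_tree_bridge:
  assumes G: "undirected_tree G" and ux: "(u, x) \<in> parcs G"
  shows "(x, u) \<notin> (parcs G - {(u, x), (x, u)})\<^sup>*"
proof
  interpret G: pair_graph G using G by (simp add: undirected_tree_def)
  define H where "H = G\<lparr>parcs := parcs G - {(u, x), (x, u)}\<rparr>"
  have H: "pverts H = pverts G" "parcs H = parcs G - {(u, x), (x, u)}"
    by (simp_all add: H_def)
  have "pair_wf_digraph H"
    by unfold_locales (auto simp: H dest: G.in_arcsD1 G.in_arcsD2)
  then interpret H: wf_digraph "with_proj H" by (simp add: wf_digraph_wp_iff)
  have neq: "u \<noteq> x" using G.no_loops' ux by auto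
  assume "(x, u) \<in> (parcs G - {(u, x), (x, u)})\<^sup>*"
  then obtain k where "(x, u) \<in> parcs H ^^ k" unfolding H by (auto dest: rtrancl_imp_relpow)
  then obtain q where "H.awalk x q u"
    using G.in_arcsD2[OF ux] by (auto simp: relpow_iff_pcas awalk_with_proj_iff H)
  from H.apath_awalk_to_apath[OF this] obtain p where "H.apath x p u" by blast
  then have p: "set p \<subseteq> parcs H" "pcas x p u" "distinct (pawalk_verts x p)"
    by (auto simp: H.apath_def awalk_with_proj_iff awalk_verts_with_proj_eq)
  have "2 \<le> length p"
  proof (cases p)
    case Nil then show ?thesis using p neq by simp
  next
    case (Cons e q)
    then show ?thesis using p H by (cases q) (auto simp: H)
  qed
  have "pre_digraph.cycle (with_proj G) ((u, x) # p)"
    unfolding pre_digraph.cycle_def awalk_with_proj_iff awalk_verts_with_proj_eq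
    using p ux G.in_arcsD1[OF ux] by (intro exI[of _ u]) (auto simp: H)
  with \<open>2 \<le> length p\<close> G show False
    unfolding undirected_tree_def by fastforce
qed

lemma undirected_tree_connected:
  assumes G: "undirected_tree G" and "u \<in> pverts G" "v \<in> pverts G"
  shows "\<exists>k. (u, v) \<in> parcs G ^^ k"
proof -
  interpret G: pair_graph G using G by (simp add: undirected_tree_def)
  have wf: "wf_digraph (with_proj G)" by (simp add: wf_digraph_wp_iff G.pair_wf_digraph)
  have "strongly_connected (with_proj G)"
    using G G.pair_sym_arcs
    by (intro wf_digraph.symmetric_connected_imp_strongly_connected[OF wf])
       (auto simp: undirected_tree_def)
  then have "u \<rightarrow>\<^sup>*\<^bsub>with_proj G\<^esub> v"
    using assms(2,3) by (auto simp: strongly_connected_def)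
  then obtain p where "pre_digraph.awalk (with_proj G) u p v"
    using wf_digraph.reachable_awalk[OF wf] by blast
  then show ?thesis by (auto simp: relpow_iff_pcas awalk_with_proj_iff)
qed

text \<open>\<open>depth\<close> is the distance to \<open>r\<close>, and \<open>par\<close> picks a
  neighbor one step closer. A second neighbor that is no deeper than \<open>u\<close> would open
  another route from \<open>u\<close> to the root, contradicting that its edge is a bridge.\<close>

lemma undirected_tree_rooted:
  assumes G: "undirected_tree G" and r: "r \<in> pverts G"
  obtains par depth where "rooted_tree G r par depth"
proof -
  interpret G: pair_graph G using G by (simp add: undirected_tree_def)
  note sym = pair_graph_arcs_symmetric[OF G.pair_graph]
  let ?E = "parcs G" and ?V = "pverts G"
  define depth where "depth w = (LEAST k. (w, r) \<in> ?E ^^ k)" for w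
  have depth_rel: "(w, r) \<in> ?E ^^ depth w" if "w \<in> ?V" for w
    unfolding depth_def using undirected_tree_connected[OF G that r] by (rule LeastI_ex)
  have depth_le: "depth w \<le> k" if "(w, r) \<in> ?E ^^ k" for w k
    unfolding depth_def using that by (rule Least_le)
  have depth_root: "depth r = 0" using depth_le[of r 0] by simp
  have "\<exists>x. (w, x) \<in> ?E \<and> depth w = Suc (depth x)" if w: "w \<in> ?V - {r}" for w
  proof (cases "depth w")
    case 0 then show ?thesis using depth_rel[of w] w by simp
  next
    case (Suc k)
    then obtain x where x: "(w, x) \<in> ?E" "(x, r) \<in> ?E ^^ k"
      using depth_rel[of w] w by (metis DiffD1 relpow_Suc_D2)
    have "depth w \<le> Suc (depth x)"
      using depth_rel[OF G.in_arcsD2[OF x(1)]] x(1) by (intro depth_le relpow_Suc_I2)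
    with depth_le[OF x(2)] Suc x(1) show ?thesis by (intro exI[of _ x]) simp
  qed
  then obtain par where par: "\<And>w. w \<in> ?V - {r} \<Longrightarrow> (w, par w) \<in> ?E \<and> depth w = Suc (depth (par w))"
    by metis
  have unique: "x = par u" if ux: "(u, x) \<in> ?E" and u: "u \<noteq> r" and le: "depth x \<le> depth u" for u x
  proof (rule ccontr)
    assume "x \<noteq> par u"
    let ?E' = "?E - {(u, x), (x, u)}"
    have neq: "u \<noteq> x" using G.no_loops' ux by auto
    have uV: "u \<in> ?V - {r}" using G.in_arcsD1[OF ux] u by simp
    \<comment> \<open>Depth strictly decreases along parents, so a vertex other than
      \<open>u\<close> that starts no deeper than \<open>u\<close> never climbs through
      \<open>u\<close>; its route therefore avoids the deleted edge.\<close>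
    have to_root: "(w, r) \<in> ?E'\<^sup>*" if "w \<in> ?V" "w \<noteq> u" "depth w \<le> depth u" for w
      using that
    proof (induction "depth w" arbitrary: w rule: less_induct)
      case less
      show ?case
      proof (cases "w = r")
        case False
        then have w: "(w, par w) \<in> ?E" "depth w = Suc (depth (par w))" using par less.prems by auto
        then have "par w \<noteq> u" using less.prems by auto
        then have "(w, par w) \<in> ?E'" using w less.prems by auto
        moreover have "(par w, r) \<in> ?E'\<^sup>*"
          using w \<open>par w \<noteq> u\<close> less.prems G.in_arcsD2[OF w(1)] by (intro less.hyps) auto
        ultimately show ?thesis by (rule converse_rtrancl_into_rtrancl)
      qed simp
    qed
    have "sym ?E'" using sym by (auto intro!: symI)
    have up: "(u, par u) \<in> ?E'" "depth u = Suc (depth (par u))"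
      using par[OF uV] \<open>x \<noteq> par u\<close> neq by auto
    then have "(par u, r) \<in> ?E'\<^sup>*"
      by (intro to_root) (auto dest: G.in_arcsD2)
    with up(1) have "(u, r) \<in> ?E'\<^sup>*" by (rule converse_rtrancl_into_rtrancl)
    then have "(r, u) \<in> ?E'\<^sup>*" by (rule symD[OF sym_rtrancl[OF \<open>sym ?E'\<close>]])
    moreover have "(x, r) \<in> ?E'\<^sup>*"
      using neq le G.in_arcsD2[OF ux] by (intro to_root) auto
    ultimately show False
      using undirected_tree_bridge[OF G ux] by (blast intro: rtrancl_trans)
  qed
  have "rooted_tree G r par depth"
  proof
    show "finite ?V" by (rule G.pair_finite_verts)
    show "par w \<in> ?V" if "w \<in> ?V - {r}" for w
      using par[OF that] by (auto dest: G.in_arcsD2)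
    show "depth w = Suc (depth (par w))" if "w \<in> ?V - {r}" for w
      using par[OF that] by simp
    show "?E = {(w, par w) | w. w \<in> ?V - {r}} \<union> {(par w, w) | w. w \<in> ?V - {r}}" (is "_ = ?R")
    proof (rule antisym; rule subrelI)
      fix u x assume ux: "(u, x) \<in> ?E"
      note V = G.in_arcsD1[OF ux] G.in_arcsD2[OF ux]
      consider "depth x \<le> depth u" "u \<noteq> r" | "depth u \<le> depth x" "x \<noteq> r"
        using ux G.no_loops' depth_root by (metis le_cases le_zero_eq)
      then show "(u, x) \<in> ?R"
      proof cases
        case 1
        then show ?thesis using unique[OF ux] V by auto
      next
        case 2
        then show ?thesis using unique[OF sym[OF ux]] V by auto
      qed
    next
      fix u x assume "(u, x) \<in> ?R"
      then show "(u, x) \<in> ?E" using par sym by blast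
    qed
  qed fact+
  then show thesis by (rule that)
qed

lemma pawalk_verts_nth:
  assumes "set p \<subseteq> R" "pcas u p v"
  shows "pawalk_verts u p ! 0 = u" "pawalk_verts u p ! length p = v"
    "length (pawalk_verts u p) = Suc (length p)"
    "i < length p \<Longrightarrow> (pawalk_verts u p ! i, pawalk_verts u p ! Suc i) \<in> R"
proof -
  have *: "pawalk_verts u p ! 0 = u" if "pcas u p v" for u p using that by (cases p) auto
  show "pawalk_verts u p ! 0 = u" using assms(2) by (rule *)
  show "pawalk_verts u p ! length p = v" "length (pawalk_verts u p) = Suc (length p)"
    using assms(2) by (induction p arbitrary: u) auto
  show "i < length p \<Longrightarrow> (pawalk_verts u p ! i, pawalk_verts u p ! Suc i) \<in> R"
    using assms
  proof (induction p arbitrary: u i)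
    case (Cons e p)
    then show ?case using *[of "snd e" p] by (cases i) (auto simp: prod_eq_iff)
  qed simp
qed

section \<open>Rooted trees are undirected trees\<close>

context rooted_tree
begin

lemma arcs_symmetric: "(u, v) \<in> parcs G \<Longrightarrow> (v, u) \<in> parcs G"
  unfolding arcs_eq by auto

lemma arc_depth_le:
  assumes "(u, x) \<in> parcs G" "depth x \<le> depth u"
  shows "u \<in> pverts G - {r}" "x = par u"
  using assms depth_par[of x] unfolding arcs_eq by auto

lemma no_long_cycle:
  assumes p: "pre_digraph.cycle (with_proj G) p" and len: "3 \<le> length p"
  shows False
proof -
  obtain u where u: "set p \<subseteq> parcs G" "pcas u p u" "distinct (tl (pawalk_verts u p))"
    using p unfolding pre_digraph.cycle_def awalk_with_proj_iff awalk_verts_with_proj_eq by auto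
  define L where "L = length p"
  define x where "x i = pawalk_verts u p ! i" for i
  note nth = pawalk_verts_nth[OF u(1,2), folded L_def, folded x_def]
  have arc: "(x i, x (Suc i)) \<in> parcs G" if "i < L" for i using nth(4) that by blast
  have inj: "i = j" if "x i = x j" "i \<in> {1..L}" "j \<in> {1..L}" for i j
  proof -
    have "tl (pawalk_verts u p) ! (i - 1) = tl (pawalk_verts u p) ! (j - 1)"
      using that nth(3) by (cases i; cases j) (auto simp: nth_tl x_def)
    then have "i - 1 = j - 1"
      using u(3) that nth(3) by (subst (asm) nth_eq_iff_index_eq) auto
    then show ?thesis using that by auto
  qed
  \<comment> \<open>Both cycle neighbours of a deepest vertex would be its parent.\<close>
  have "Max ((depth \<circ> x) ` {1..L}) \<in> (depth \<circ> x) ` {1..L}"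
    using len L_def by (intro Max_in) auto
  then obtain i where i: "i \<in> {1..L}" "Max ((depth \<circ> x) ` {1..L}) = depth (x i)" by auto
  have max: "depth (x j) \<le> depth (x i)" if "j \<in> {1..L}" for j
    unfolding i(2)[symmetric] using that by (intro Max_ge) auto
  \<comment> \<open>Positions \<open>0\<close> and \<open>L\<close> hold the same vertex, so
    \<open>1..L\<close> lists each cycle vertex once and the neighbors wrap around. They are
    different positions because the length is at least 3.\<close>
  define j where "j = (if i = 1 then L else i - 1)"
  define k where "k = (if i = L then 1 else Suc i)"
  have jk: "j \<in> {1..L}" "k \<in> {1..L}" "j \<noteq> k" using i(1) len by (auto simp: j_def k_def L_def)
  have "(x j, x i) \<in> parcs G"
    using arc[of "i - 1"] i(1) nth(1,2) by (auto simp: j_def)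
  then have "x j = par (x i)"
    using arcs_symmetric max[OF jk(1)] by (intro arc_depth_le)
  moreover have "(x i, x k) \<in> parcs G"
    using arc[of i] arc[of 0] i(1) nth(1,2) by (auto simp: k_def)
  then have "x k = par (x i)"
    using max[OF jk(2)] by (intro arc_depth_le)
  ultimately show False using inj[of j k] jk by simp
qed

lemma relpow_symmetric: "(u, v) \<in> parcs G ^^ k \<Longrightarrow> (v, u) \<in> parcs G ^^ k"
proof (induction k arbitrary: v)
  case (Suc k)
  then show ?case using arcs_symmetric by (meson relpow_Suc_E relpow_Suc_I2)
qed auto

lemma par_funpow:
  assumes "w \<in> pverts G" "i \<le> depth w"
  shows "(par ^^ i) w \<in> pverts G" "depth ((par ^^ i) w) = depth w - i"
    "(w, (par ^^ i) w) \<in> parcs G ^^ i"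
proof -
  have "(par ^^ i) w \<in> pverts G \<and> depth ((par ^^ i) w) = depth w - i
      \<and> (w, (par ^^ i) w) \<in> parcs G ^^ i"
    using assms(2)
  proof (induction i)
    case (Suc i)
    then have *: "(par ^^ i) w \<in> pverts G - {r}" using depth_root by auto
    then have "((par ^^ i) w, (par ^^ Suc i) w) \<in> parcs G" unfolding arcs_eq by auto
    with * Suc par_in[OF *] depth_par[OF *] show ?case by (auto intro: relcompI)
  qed (use assms in auto)
  then show "(par ^^ i) w \<in> pverts G" "depth ((par ^^ i) w) = depth w - i"
    "(w, (par ^^ i) w) \<in> parcs G ^^ i" by auto
qed

lemma depth_eq_0: "w \<in> pverts G \<Longrightarrow> depth w = 0 \<longleftrightarrow> w = r"
  using depth_par[of w] depth_root by (cases "w = r") auto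

lemma par_funpow_depth: "w \<in> pverts G \<Longrightarrow> (par ^^ depth w) w = r"
  using par_funpow(1,2)[of w "depth w"] depth_eq_0 by auto

lemma pair_wf_digraph: "pair_wf_digraph G"
  by unfold_locales (auto simp: arcs_eq root_in intro: par_in)

lemma undirected_tree: "undirected_tree G"
  unfolding undirected_tree_def
proof (intro conjI)
  have "e \<in> pverts G \<times> pverts G" if "e \<in> parcs G" for e
    using that unfolding arcs_eq by (auto intro: par_in)
  then have "finite (parcs G)"
    using finite_verts by (intro finite_subset[of "parcs G" "pverts G \<times> pverts G"]) auto
  moreover have "fst e \<noteq> snd e" if "e \<in> parcs G" for e
    using that depth_par unfolding arcs_eq by force
  moreover have "symmetric (with_proj G)"
    unfolding symmetric_def using arcs_symmetric by (auto intro: symI)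
  ultimately show "pair_graph G"
    using pair_wf_digraph finite_verts unfolding pair_wf_digraph_def
    by unfold_locales auto
  interpret wf_digraph "with_proj G" using pair_wf_digraph by (simp add: wf_digraph_wp_iff)
  have "mk_symmetric (with_proj G) = G"
    using arcs_symmetric by (intro pair_pre_digraph.equality) (auto simp: mk_symmetric_def)
  moreover have "u \<rightarrow>\<^sup>*\<^bsub>with_proj G\<^esub> v" if "u \<in> pverts G" "v \<in> pverts G" for u v
  proof -
    have "(u, r) \<in> parcs G ^^ depth u" "(r, v) \<in> parcs G ^^ depth v"
      using par_funpow(3)[OF that(1) order_refl] par_funpow(3)[OF that(2) order_refl]
        par_funpow_depth that by (auto intro: relpow_symmetric)
    then have "(u, v) \<in> parcs G ^^ (depth u + depth v)"
      by (auto simp: relpow_add)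
    then show ?thesis
      using that by (auto simp: reachable_awalk relpow_iff_pcas awalk_with_proj_iff)
  qed
  ultimately show "Digraph_Component.connected (with_proj G)"
    using root_in by (auto simp: connected_def strongly_connected_def)
  show "\<not> (\<exists>p. pre_digraph.cycle (with_proj G) p \<and> 3 \<le> length p)"
    using no_long_cycle by blast
qed

end

section \<open>The lower bound and its equality case\<close>

text \<open>The weights \<open>1, 3, ..., 2k - 1\<close> of a branch without side branches, squared
  and counted above the baseline 1 per vertex.\<close>

definition chain_excess :: "nat \<Rightarrow> real" where
  "chain_excess k = (\<Sum>i<k. (2 * real i + 1)\<^sup>2 - 1)"

lemma chain_excess_Suc: "chain_excess (Suc k) = chain_excess k + 4 * real k * (real k + 1)"
  by (simp add: chain_excess_def power2_eq_square algebra_simps)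

lemma chain_excess_closed: "chain_excess k = 4 * (real k ^ 3 - real k) / 3"
proof (induction k)
  case (Suc k)
  have "(real k + 1) ^ 3 = real k ^ 3 + 3 * real k * real k + 3 * real k + 1"
    by (simp add: power3_eq_cube algebra_simps)
  then show ?case using Suc by (simp add: chain_excess_Suc algebra_simps)
qed (simp add: chain_excess_def)

text \<open>The slope is the increment from \<open>m\<close> to \<open>m + 1\<close>, so the line is
  the chord through these two points. The gap factors as
  \<open>4/3 * (k - m) * (k - m - 1) * (k + 2 * m + 1)\<close>, which is nonnegative because no
  integer lies strictly between \<open>m\<close> and \<open>m + 1\<close>.\<close>

lemma chain_excess_secant:
  "chain_excess m + 4 * real m * (real m + 1) * (real k - real m) \<le> chain_excess k" (is ?le)
  "chain_excess k = chain_excess m + 4 * real m * (real m + 1) * (real k - real m)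
    \<Longrightarrow> k = m \<or> k = Suc m" (is "?eq \<Longrightarrow> _")
proof -
  define x y where "x = real k" and "y = real m"
  have diff: "chain_excess k - (chain_excess m + 4 * y * (y + 1) * (x - y))
      = 4 / 3 * ((x - y) * (x - y - 1)) * (x + 2 * y + 1)"
    unfolding chain_excess_closed x_def[symmetric] y_def[symmetric]
    by (simp add: algebra_simps power3_eq_cube diff_divide_distrib add_divide_distrib)
  have pos: "0 < x + 2 * y + 1" by (simp add: x_def y_def add_nonneg_pos)
  have nonneg: "0 \<le> (x - y) * (x - y - 1)"
  proof (cases "k \<le> m")
    case True
    then show ?thesis by (intro mult_nonpos_nonpos) (auto simp: x_def y_def)
  next
    case False
    then show ?thesis by (intro mult_nonneg_nonneg) (auto simp: x_def y_def)
  qed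
  have "0 \<le> 4 / 3 * ((x - y) * (x - y - 1)) * (x + 2 * y + 1)"
    by (rule mult_nonneg_nonneg[OF mult_nonneg_nonneg[OF _ nonneg]]) (use pos in auto)
  then show ?le using diff by (simp add: x_def y_def)
  assume ?eq
  then have "4 / 3 * ((x - y) * (x - y - 1)) * (x + 2 * y + 1) = 0"
    using diff by (simp add: x_def y_def)
  then have "x - y = 0 \<or> x - y - 1 = 0" using pos by simp
  then show "k = m \<or> k = Suc m" by (auto simp: x_def y_def)
qed

text \<open>One chord, at \<open>m = d div 2\<close>, serves both arguments: the two bounds add up
  to a function of \<open>k + l\<close> alone, and the chord is exact at both balanced arguments for
  either parity of \<open>d\<close>. For \<open>2 \<le> d\<close> the slope is positive, so equality
  also forces \<open>k + l = d\<close>.\<close>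

lemma chain_excess_balanced:
  assumes "d \<le> k + l"
  shows "chain_excess (d div 2) + chain_excess (d - d div 2) \<le> chain_excess k + chain_excess l"
    and "2 \<le> d \<Longrightarrow> chain_excess k + chain_excess l = chain_excess (d div 2) + chain_excess (d - d div 2)
      \<Longrightarrow> k = d div 2 \<and> l = d - d div 2 \<or> l = d div 2 \<and> k = d - d div 2"
proof -
  define m where "m = d div 2"
  define s where "s = 4 * real m * (real m + 1)"
  have d: "d - m = m \<or> d - m = Suc m" "2 * m \<le> d" by (auto simp: m_def)
  have lever: "chain_excess (d - m) = chain_excess m + s * (real d - 2 * real m)"
    using d(1)
  proof
    assume "d - m = m"
    then have "real d - 2 * real m = 0" using d(2) by linarith
    then show ?thesis using \<open>d - m = m\<close> by simp
  next
    assume "d - m = Suc m"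
    then have "real d - 2 * real m = 1" using d(2) by linarith
    then show ?thesis using \<open>d - m = Suc m\<close> by (simp add: chain_excess_Suc s_def)
  qed
  have "0 \<le> s" by (simp add: s_def)
  then have mono: "s * (real d - 2 * real m) \<le> s * (real k + real l - 2 * real m)"
    using assms by (intro mult_left_mono) auto
  have split: "s * (real k + real l - 2 * real m) = s * (real k - real m) + s * (real l - real m)"
    by (simp add: algebra_simps)
  note sec = chain_excess_secant[where m = m, folded s_def]
  show "chain_excess (d div 2) + chain_excess (d - d div 2) \<le> chain_excess k + chain_excess l"
    using sec(1)[of k] sec(1)[of l] lever mono split unfolding m_def[symmetric] by linarith
  assume "2 \<le> d"
    and "chain_excess k + chain_excess l = chain_excess (d div 2) + chain_excess (d - d div 2)"
  then have eq: "chain_excess k + chain_excess l = chain_excess m + chain_excess (d - m)"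
    by (simp add: m_def)
  have "0 < s" using \<open>2 \<le> d\<close> by (simp add: s_def m_def)
  have kl: "s * (real d - 2 * real m) = s * (real k + real l - 2 * real m)"
    "chain_excess k = chain_excess m + s * (real k - real m)"
    "chain_excess l = chain_excess m + s * (real l - real m)"
    using sec(1)[of k] sec(1)[of l] eq lever mono split by linarith+
  then have "real d - 2 * real m = real k + real l - 2 * real m" using \<open>0 < s\<close> by simp
  then have "d = k + l" by linarith
  then show "k = d div 2 \<and> l = d - d div 2 \<or> l = d div 2 \<and> k = d - d div 2"
    using sec(2)[OF kl(2)] sec(2)[OF kl(3)] d unfolding m_def[symmetric] by auto
qed

text \<open>The climbs from \<open>u\<close> and \<open>v\<close> up to a common ancestor, with
  \<open>k\<close> and \<open>l\<close> steps. The ancestor need not be \<open>r\<close>, and either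
  climb may be empty.\<close>

locale forked_tree = rooted_tree +
  fixes u v :: 'a and k l :: nat
  assumes u_in: "u \<in> pverts G" and v_in: "v \<in> pverts G"
    and k_le: "k \<le> depth u" and l_le: "l \<le> depth v"
    and meet: "(par ^^ k) u = (par ^^ l) v"
    and disjoint: "\<And>i j. i < k \<Longrightarrow> j < l \<Longrightarrow> (par ^^ i) u \<noteq> (par ^^ j) v"
begin

lemma swap: "forked_tree G r par depth v u l k"
proof unfold_locales
  show "(par ^^ l) v = (par ^^ k) u" using meet by simp
  show "(par ^^ i) v \<noteq> (par ^^ j) u" if "i < l" "j < k" for i j
    using disjoint[OF that(2,1)] by simp
qed (fact u_in v_in k_le l_le)+

text \<open>The range stops before \<open>k\<close>: the meeting vertex is left out, so a branch
  avoids \<open>r\<close> even if the climbs meet there.\<close>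

definition branch :: "'a set" where
  "branch = (\<lambda>i. (par ^^ i) u) ` {..<k}"

lemma branch_subset: "branch \<subseteq> pverts G - {r}"
proof
  fix w assume "w \<in> branch"
  then obtain i where i: "i < k" "w = (par ^^ i) u" by (auto simp: branch_def)
  then show "w \<in> pverts G - {r}"
    using par_funpow(1,2)[OF u_in, of i] k_le depth_root by auto
qed

lemma branch_inj: "inj_on (\<lambda>i. (par ^^ i) u) {..k}"
proof (rule inj_onI)
  fix i j assume ij: "i \<in> {..k}" "j \<in> {..k}" "(par ^^ i) u = (par ^^ j) u"
  then have "depth u - i = depth u - j"
    using par_funpow(2)[OF u_in, of i] par_funpow(2)[OF u_in, of j] k_le by auto
  then show "i = j" using ij k_le by auto
qed

lemma branch_inj': "inj_on (\<lambda>i. (par ^^ i) u) {..<k}"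
  by (rule inj_on_subset[OF branch_inj]) auto

lemma card_branch: "card branch = k"
  unfolding branch_def using card_image[OF branch_inj'] by simp

lemma sum_branch: "(\<Sum>w\<in>branch. f w) = (\<Sum>i<k. f ((par ^^ i) u))"
  unfolding branch_def by (simp add: sum.reindex[OF branch_inj'])

lemma top_notin_branch: "(par ^^ k) u \<notin> branch"
  unfolding branch_def using inj_onD[OF branch_inj, of k] by fastforce

lemma branch_child: "i < k \<Longrightarrow> (par ^^ i) u \<in> children ((par ^^ Suc i) u)"
  using branch_subset by (auto simp: children_def branch_def)

end

context rooted_tree
begin

lemma weights_child_nonneg: "weights a \<Longrightarrow> c \<in> children w \<Longrightarrow> 0 \<le> a c + 1"
  using weights_ge_1[of a c] childrenD(1)[of c w] by simp

lemma weights_child: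
  assumes a: "weights a" and c: "c \<in> children w" and w: "w \<noteq> r" "w \<in> pverts G"
  shows "a c + 2 \<le> a w"
proof -
  have "a c + 1 \<le> (\<Sum>c\<in>children w. a c + 1)"
    using finite_children weights_child_nonneg[OF a] by (intro member_le_sum[OF c]) auto
  then show ?thesis using weightsD[OF a, of w] w by simp
qed

text \<open>A second child adds its own weight plus 1, hence at least 2, on top of the unavoidable
  increase by 2. This gap detects side branches in the equality case.\<close>

lemma weights_two_children:
  assumes a: "weights a" and c: "c \<in> children w" "b \<in> children w" "b \<noteq> c"
    and w: "w \<noteq> r" "w \<in> pverts G"
  shows "a c + 4 \<le> a w"
proof -
  have "(\<Sum>x\<in>{b, c}. a x + 1) \<le> (\<Sum>c\<in>children w. a c + 1)"
    using finite_children weights_child_nonneg[OF a] c by (intro sum_mono2) auto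
  moreover have "1 \<le> a b" using weights_ge_1[OF a] childrenD(1)[OF c(2)] by simp
  ultimately show ?thesis using weightsD[OF a, of w] w c(3) by simp
qed

text \<open>Take the least number of steps from \<open>u\<close> that reaches an ancestor of
  \<open>v\<close>; the root shows that there is one. Minimality makes the climbs disjoint, and
  joining them gives a walk of length \<open>k + l\<close> from \<open>u\<close> to
  \<open>v\<close>.\<close>

lemma forked_tree_of_far_pair:
  assumes uv: "u \<in> pverts G" "v \<in> pverts G"
    and far: "\<And>k. (u, v) \<in> parcs G ^^ k \<Longrightarrow> d \<le> k"
  obtains k l where "forked_tree G r par depth u v k l" "d \<le> k + l"
proof -
  define M where "M k \<longleftrightarrow> k \<le> depth u \<and> (\<exists>l\<le>depth v. (par ^^ k) u = (par ^^ l) v)" for k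
  have "M (depth u)"
    unfolding M_def using par_funpow_depth[OF uv(1)] par_funpow_depth[OF uv(2)]
    by (auto intro!: exI[of _ "depth v"])
  define k where "k = (LEAST k. M k)"
  have "M k" unfolding k_def using \<open>M (depth u)\<close> by (rule LeastI)
  then obtain l where kl: "k \<le> depth u" "l \<le> depth v" "(par ^^ k) u = (par ^^ l) v"
    by (auto simp: M_def)
  have "forked_tree G r par depth u v k l"
  proof unfold_locales
    fix i j assume ij: "i < k" "j < l"
    then have "\<not> M i" unfolding k_def by (intro not_less_Least)
    then show "(par ^^ i) u \<noteq> (par ^^ j) v" using ij kl by (auto simp: M_def)
  qed fact+
  moreover have "(u, v) \<in> parcs G ^^ (k + l)"
    using par_funpow(3)[OF uv(1) kl(1)] relpow_symmetric[OF par_funpow(3)[OF uv(2) kl(2)]] kl(3)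
    by (auto simp: relpow_add)
  ultimately show thesis using far that by blast
qed

end

section \<open>The lower bound for the excess and its equality case\<close>

context forked_tree
begin

interpretation S: forked_tree G r par depth v u l k by (rule swap)

lemma branches_disjoint: "branch \<inter> S.branch = {}"
  using disjoint by (auto simp: branch_def S.branch_def)

lemma branch_weight_ge:
  assumes a: "weights a" and "i < k"
  shows "2 * real i + 1 \<le> a ((par ^^ i) u)"
  using assms(2)
proof (induction i)
  case 0
  then show ?case
    using weights_ge_1[OF a, of u] branch_subset by (force simp: branch_def)
next
  case (Suc i)
  then have "(par ^^ Suc i) u \<in> pverts G - {r}" using branch_subset by (auto simp: branch_def)
  then have "a ((par ^^ i) u) + 2 \<le> a ((par ^^ Suc i) u)"
    using Suc.prems by (intro weights_child[OF a] branch_child) auto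
  then show ?case using Suc by simp
qed

lemma sum_excess_split:
  "(\<Sum>w\<in>pverts G - {r}. (a w)\<^sup>2 - 1 :: real)
    = (\<Sum>i<k. (a ((par ^^ i) u))\<^sup>2 - 1) + (\<Sum>j<l. (a ((par ^^ j) v))\<^sup>2 - 1)
      + (\<Sum>w\<in>pverts G - {r} - (branch \<union> S.branch). (a w)\<^sup>2 - 1)"
proof -
  have fin: "finite branch" "finite S.branch" by (simp_all add: branch_def S.branch_def)
  have "(\<Sum>w\<in>pverts G - {r}. (a w)\<^sup>2 - 1)
    = (\<Sum>w\<in>pverts G - {r} - (branch \<union> S.branch). (a w)\<^sup>2 - 1) + (\<Sum>w\<in>branch \<union> S.branch. (a w)\<^sup>2 - 1)"
    using finite_verts branch_subset S.branch_subset by (intro sum.subset_diff) auto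
  also have "(\<Sum>w\<in>branch \<union> S.branch. (a w)\<^sup>2 - 1)
    = (\<Sum>w\<in>branch. (a w)\<^sup>2 - 1) + (\<Sum>w\<in>S.branch. (a w)\<^sup>2 - 1)"
    using fin branches_disjoint by (rule sum.union_disjoint)
  finally show ?thesis by (simp add: sum_branch S.sum_branch)
qed

lemma excess_le_sum_weights:
  assumes a: "weights a"
  shows "chain_excess k + chain_excess l \<le> (\<Sum>w\<in>pverts G - {r}. (a w)\<^sup>2 - 1)"
proof -
  have "chain_excess k \<le> (\<Sum>i<k. (a ((par ^^ i) u))\<^sup>2 - 1)"
    unfolding chain_excess_def using branch_weight_ge[OF a]
    by (intro sum_mono diff_right_mono power_mono) auto
  moreover have "chain_excess l \<le> (\<Sum>j<l. (a ((par ^^ j) v))\<^sup>2 - 1)"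
    unfolding chain_excess_def using forked_tree.branch_weight_ge[OF swap a]
    by (intro sum_mono diff_right_mono power_mono) auto
  moreover have "0 \<le> (\<Sum>w\<in>pverts G - {r} - (branch \<union> S.branch). (a w)\<^sup>2 - 1)"
    using weights_ge_1[OF a] by (intro sum_nonneg) (auto intro: one_le_power)
  ultimately show ?thesis unfolding sum_excess_split by simp
qed

text \<open>Over both branches and the remaining vertices, the differences from the bound are
  termwise nonnegative with total 0, so each of them vanishes. The statement for the branch of
  \<open>v\<close> follows by \<open>swap\<close>.\<close>

lemma tight_weights:
  assumes a: "weights a"
    and tight: "(\<Sum>w\<in>pverts G - {r}. (a w)\<^sup>2 - 1) = chain_excess k + chain_excess l"
  shows "i < k \<Longrightarrow> a ((par ^^ i) u) = 2 * real i + 1"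
    and "w \<in> pverts G - {r} - (branch \<union> S.branch) \<Longrightarrow> a w = 1"
proof -
  let ?R = "pverts G - {r} - (branch \<union> S.branch)"
  have P: "\<And>i. i \<in> {..<k} \<Longrightarrow> 0 \<le> (a ((par ^^ i) u))\<^sup>2 - 1 - ((2 * real i + 1)\<^sup>2 - 1)"
    using branch_weight_ge[OF a] by (simp add: power_mono)
  have Q: "\<And>i. i \<in> {..<l} \<Longrightarrow> 0 \<le> (a ((par ^^ i) v))\<^sup>2 - 1 - ((2 * real i + 1)\<^sup>2 - 1)"
    using forked_tree.branch_weight_ge[OF swap a] by (simp add: power_mono)
  have R: "\<And>w. w \<in> ?R \<Longrightarrow> 0 \<le> (a w)\<^sup>2 - 1"
    using weights_ge_1[OF a] by (auto intro: one_le_power)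
  have "(\<Sum>i<k. (a ((par ^^ i) u))\<^sup>2 - 1 - ((2 * real i + 1)\<^sup>2 - 1))
      + (\<Sum>i<l. (a ((par ^^ i) v))\<^sup>2 - 1 - ((2 * real i + 1)\<^sup>2 - 1)) + (\<Sum>w\<in>?R. (a w)\<^sup>2 - 1) = 0"
    using tight unfolding sum_excess_split chain_excess_def
    using sum_subtractf[of "\<lambda>i. (a ((par ^^ i) u))\<^sup>2 - 1" "\<lambda>i. (2 * real i + 1)\<^sup>2 - 1" "{..<k}"]
      sum_subtractf[of "\<lambda>i. (a ((par ^^ i) v))\<^sup>2 - 1" "\<lambda>i. (2 * real i + 1)\<^sup>2 - 1" "{..<l}"]
    by linarith
  moreover have "0 \<le> (\<Sum>i<k. (a ((par ^^ i) u))\<^sup>2 - 1 - ((2 * real i + 1)\<^sup>2 - 1))"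
    using P by (rule sum_nonneg)
  moreover have "0 \<le> (\<Sum>i<l. (a ((par ^^ i) v))\<^sup>2 - 1 - ((2 * real i + 1)\<^sup>2 - 1))"
    using Q by (rule sum_nonneg)
  moreover have "0 \<le> (\<Sum>w\<in>?R. (a w)\<^sup>2 - 1)"
    using R by (rule sum_nonneg)
  ultimately have zero: "(\<Sum>i<k. (a ((par ^^ i) u))\<^sup>2 - 1 - ((2 * real i + 1)\<^sup>2 - 1)) = 0"
    "(\<Sum>w\<in>?R. (a w)\<^sup>2 - 1) = 0"
    by linarith+
  show "a ((par ^^ i) u) = 2 * real i + 1" if "i < k"
  proof -
    have "(a ((par ^^ i) u))\<^sup>2 = (2 * real i + 1)\<^sup>2"
      using sum_nonneg_0[OF _ P zero(1), of i] that by simp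
    then show ?thesis
      by (rule power2_eq_imp_eq) (use branch_weight_ge[OF a that] in auto)
  qed
  show "a w = 1" if "w \<in> ?R"
  proof -
    have "(a w)\<^sup>2 = 1\<^sup>2"
      using sum_nonneg_0[OF _ R zero(2) that] finite_verts by simp
    then show ?thesis
      by (rule power2_eq_imp_eq) (use weights_ge_1[OF a, of w] that in auto)
  qed
qed

text \<open>A meeting vertex other than \<open>r\<close> would lie off both branches and so have
  weight 1, yet its child on the branch of \<open>u\<close> pushes the weight to at least 3.\<close>

lemma tight_top:
  assumes a: "weights a"
    and tight: "(\<Sum>w\<in>pverts G - {r}. (a w)\<^sup>2 - 1) = chain_excess k + chain_excess l"
    and "0 < k"
  shows "(par ^^ k) u = r"
proof (rule ccontr)
  assume neq: "(par ^^ k) u \<noteq> r"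
  have in_V: "(par ^^ k) u \<in> pverts G" using par_funpow(1)[OF u_in k_le] .
  have "(par ^^ k) u \<notin> S.branch" using S.top_notin_branch meet by simp
  then have "a ((par ^^ k) u) = 1"
    using neq in_V top_notin_branch by (intro tight_weights(2)[OF a tight]) auto
  moreover obtain i where "k = Suc i" using \<open>0 < k\<close> gr0_implies_Suc by blast
  then have "a ((par ^^ i) u) + 2 \<le> a ((par ^^ k) u)"
    using branch_child[of i] neq in_V by (intro weights_child[OF a]) auto
  moreover have "1 \<le> a ((par ^^ i) u)"
    using branch_weight_ge[OF a, of i] \<open>k = Suc i\<close> by simp
  ultimately show False by simp
qed

text \<open>The weight \<open>2 * i + 1\<close> is used up by the branch vertex just below, or by
  the bottom vertex itself when \<open>i = 0\<close>; any further child would exceed it.\<close>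

lemma tight_child_branch:
  assumes a: "weights a"
    and tight: "(\<Sum>w\<in>pverts G - {r}. (a w)\<^sup>2 - 1) = chain_excess k + chain_excess l"
    and w: "w \<in> pverts G - {r}" "par w \<in> branch"
  shows "w \<in> branch"
proof (rule ccontr)
  assume off: "w \<notin> branch"
  obtain i where i: "i < k" "par w = (par ^^ i) u" using w by (auto simp: branch_def)
  have pw: "par w \<noteq> r" "par w \<in> pverts G" using w branch_subset by auto
  have w': "w \<in> children (par w)" using w by (simp add: children_def)
  have aw: "1 \<le> a w" using weights_ge_1[OF a w(1)] .
  have val: "a (par w) = 2 * real i + 1" using tight_weights(1)[OF a tight i(1)] i by simp
  show False
  proof (cases i)
    case 0
    then show False using weights_child[OF a w' pw] val aw by simp
  next
    case (Suc j)
    have "(par ^^ j) u \<in> children (par w)" using branch_child[of j] i Suc by simp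
    moreover have "(par ^^ j) u \<noteq> w" using off i Suc by (auto simp: branch_def)
    ultimately have "a ((par ^^ j) u) + 4 \<le> a (par w)"
      by (intro weights_two_children[OF a _ w' _ pw]) auto
    then show False
      using val Suc tight_weights(1)[OF a tight, of j] i by simp
  qed
qed

text \<open>A parent on a branch is excluded by \<open>tight_child_branch\<close>; a non-root parent
  off the branches would have weight 1 in spite of having a child.\<close>

lemma tight_off_branches:
  assumes a: "weights a"
    and tight: "(\<Sum>w\<in>pverts G - {r}. (a w)\<^sup>2 - 1) = chain_excess k + chain_excess l"
    and w: "w \<in> pverts G - {r} - (branch \<union> S.branch)"
  shows "par w = r"
proof (rule ccontr)
  assume neq: "par w \<noteq> r"
  have pw: "par w \<in> pverts G" using par_in w by blast
  have "par w \<notin> branch" using tight_child_branch[OF a tight] w by blast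
  moreover have "par w \<notin> S.branch"
    using forked_tree.tight_child_branch[OF swap a tight[unfolded add.commute[of "chain_excess k"]]] w
    by blast
  ultimately have "a (par w) = 1"
    using neq pw by (intro tight_weights(2)[OF a tight]) auto
  moreover have "a w + 2 \<le> a (par w)"
    using w neq pw by (intro weights_child[OF a]) (auto simp: children_def)
  moreover have "1 \<le> a w" using weights_ge_1[OF a, of w] w by blast
  ultimately show False by simp
qed

end

section \<open>Isomorphisms\<close>

text \<open>A library isomorphism carries separate maps for arcs, heads and tails. Since the arcs
  here are pairs of vertices, all of these are determined by the vertex map.\<close>

lemma digraph_iso_with_proj_iff:
  assumes "pair_wf_digraph G"
  shows "digraph_iso (with_proj G) (with_proj H) \<longleftrightarrow>
    (\<exists>g. inj_on g (pverts G) \<and> pverts H = g ` pverts G \<and> parcs H = map_prod g g ` parcs G)"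
proof
  assume "digraph_iso (with_proj G) (with_proj H)"
  then obtain h where h: "pre_digraph.digraph_isomorphism (with_proj G) h"
    and H: "with_proj H = app_iso h (with_proj G)"
    by (auto simp: digraph_iso_def)
  have V: "pverts H = iso_verts h ` pverts G" and E: "parcs H = iso_arcs h ` parcs G"
    and tl: "iso_tail h = fst" and hd: "iso_head h = snd"
    using arg_cong[OF H, of verts] arg_cong[OF H, of arcs] arg_cong[OF H, of tail]
      arg_cong[OF H, of head] by simp_all
  have "iso_arcs h e = map_prod (iso_verts h) (iso_verts h) e" if "e \<in> parcs G" for e
    using h that unfolding pre_digraph.digraph_isomorphism_def
    by (auto simp: tl hd map_prod_def split_beta prod_eq_iff)
  then have "parcs H = map_prod (iso_verts h) (iso_verts h) ` parcs G"
    unfolding E by (rule image_cong[OF refl])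
  then show "\<exists>g. inj_on g (pverts G) \<and> pverts H = g ` pverts G \<and> parcs H = map_prod g g ` parcs G"
    using h V unfolding pre_digraph.digraph_isomorphism_def by auto
next
  assume "\<exists>g. inj_on g (pverts G) \<and> pverts H = g ` pverts G \<and> parcs H = map_prod g g ` parcs G"
  then obtain g where g: "inj_on g (pverts G)" "pverts H = g ` pverts G"
    "parcs H = map_prod g g ` parcs G" by blast
  define h where "h = \<lparr>iso_verts = g, iso_arcs = map_prod g g, iso_head = snd, iso_tail = fst\<rparr>"
  have "parcs G \<subseteq> pverts G \<times> pverts G"
    using assms by (auto dest: pair_wf_digraph.in_arcsD1 pair_wf_digraph.in_arcsD2)
  then have "inj_on (map_prod g g) (parcs G)"
    using map_prod_inj_on[OF g(1) g(1)] by (rule inj_on_subset[rotated])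
  then have "pre_digraph.digraph_isomorphism (with_proj G) h"
    using assms g(1) by (auto simp: pre_digraph.digraph_isomorphism_def h_def wf_digraph_wp_iff)
  moreover have "with_proj H = app_iso h (with_proj G)"
    by (simp add: app_iso_def with_proj_def h_def g)
  ultimately show "digraph_iso (with_proj G) (with_proj H)"
    by (auto simp: digraph_iso_def)
qed

lemma (in rooted_tree) image_arcs_eq:
  "map_prod f f ` parcs G
    = (\<lambda>w. (f w, f (par w))) ` (pverts G - {r}) \<union> (\<lambda>w. (f (par w), f w)) ` (pverts G - {r})"
proof -
  have "parcs G = (\<lambda>w. (w, par w)) ` (pverts G - {r}) \<union> (\<lambda>w. (par w, w)) ` (pverts G - {r})"
    unfolding arcs_eq by blast
  then show ?thesis by (simp add: image_Un image_image)
qed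

text \<open>A vertex bijection between rooted trees that matches the roots preserves adjacency as
  soon as it commutes with the parent maps.\<close>

lemma (in rooted_tree) arcs_eq_image:
  assumes "rooted_tree H (f r) par' depth'" and "inj_on f (pverts G)" and "pverts H = f ` pverts G"
    and par': "\<And>w. w \<in> pverts G - {r} \<Longrightarrow> par' (f w) = f (par w)"
  shows "parcs H = map_prod f f ` parcs G"
proof -
  interpret H: rooted_tree H "f r" par' depth' by fact
  have "pverts H - {f r} = f ` (pverts G - {r})"
    using inj_on_image_set_diff[OF assms(2), of "pverts G" "{r}"] assms(3) root_in by simp
  then have "{(w, par' w) | w. w \<in> pverts H - {f r}} = (\<lambda>w. (f w, par' (f w))) ` (pverts G - {r})"
    and "{(par' w, w) | w. w \<in> pverts H - {f r}} = (\<lambda>w. (par' (f w), f w)) ` (pverts G - {r})"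
    by auto
  then have "parcs H = (\<lambda>w. (f w, f (par w))) ` (pverts G - {r}) \<union> (\<lambda>w. (f (par w), f w)) ` (pverts G - {r})"
    unfolding H.arcs_eq using par' by (simp cong: image_cong_simp)
  also have "\<dots> = map_prod f f ` parcs G"
    by (rule image_arcs_eq[symmetric])
  finally show ?thesis .
qed

lemma (in rooted_tree) rooted_tree_image:
  assumes g: "inj_on g (pverts G)" and H: "pverts H = g ` pverts G" "parcs H = map_prod g g ` parcs G"
  defines "i \<equiv> the_inv_into (pverts G) g"
  shows "rooted_tree H (g r) (g \<circ> par \<circ> i) (depth \<circ> i)"
proof -
  have i: "i (g w) = w" if "w \<in> pverts G" for w
    using the_inv_into_f_f[OF g that] by (simp add: i_def)
  have S: "pverts H - {g r} = g ` (pverts G - {r})"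
    using inj_on_image_set_diff[OF g, of "pverts G" "{r}"] H root_in by simp
  show ?thesis
  proof
    show "finite (pverts H)" using H finite_verts by simp
    show "g r \<in> pverts H" using H root_in by simp
    show "(depth \<circ> i) (g r) = 0" using i[OF root_in] depth_root by simp
    fix w assume "w \<in> pverts H - {g r}"
    then obtain x where x: "w = g x" "x \<in> pverts G - {r}" unfolding S by blast
    show "(g \<circ> par \<circ> i) w \<in> pverts H" using x i par_in H by auto
    show "(depth \<circ> i) w = Suc ((depth \<circ> i) ((g \<circ> par \<circ> i) w))"
      using x i par_in[OF x(2)] depth_par[OF x(2)] by simp
  next
    have "{(w, (g \<circ> par \<circ> i) w) | w. w \<in> pverts H - {g r}} = (\<lambda>w. (g w, g (par w))) ` (pverts G - {r})"
      and "{((g \<circ> par \<circ> i) w, w) | w. w \<in> pverts H - {g r}} = (\<lambda>w. (g (par w), g w)) ` (pverts G - {r})"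
      unfolding S using i by force+
    moreover have "map_prod g g ` parcs G
        = (\<lambda>w. (g w, g (par w))) ` (pverts G - {r}) \<union> (\<lambda>w. (g (par w), g w)) ` (pverts G - {r})"
      by (rule image_arcs_eq)
    ultimately show "parcs H = {(w, (g \<circ> par \<circ> i) w) | w. w \<in> pverts H - {g r}}
        \<union> {((g \<circ> par \<circ> i) w, w) | w. w \<in> pverts H - {g r}}"
      using H by simp
  qed
qed

text \<open>Only weights are transported, not the law of the walk: the relabelled weights solve the
  recursion in \<open>H\<close>, and the meeting time depends on nothing but the weights and the
  order.\<close>

lemma (in rooted_tree) meeting_time_image:
  assumes g: "inj_on g (pverts G)" and H: "pverts H = g ` pverts G" "parcs H = map_prod g g ` parcs G"
  shows "meeting_time H (g r) = meeting_time G r"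
proof -
  define i where "i = the_inv_into (pverts G) g"
  have i: "i (g w) = w" if "w \<in> pverts G" for w
    using the_inv_into_f_f[OF g that] by (simp add: i_def)
  interpret H: rooted_tree H "g r" "g \<circ> par \<circ> i" "depth \<circ> i"
    unfolding i_def by (rule rooted_tree_image[OF assms])
  have S: "pverts H - {g r} = g ` (pverts G - {r})"
    using inj_on_image_set_diff[OF g, of "pverts G" "{r}"] H root_in by simp
  obtain a where a: "weights a" using weights_hitting_time by blast
  have inj: "inj_on g A" if "A \<subseteq> pverts G" for A using g that by (rule inj_on_subset)
  have ch: "H.children (g w) = g ` children w" if "w \<in> pverts G" for w
  proof -
    have "g (par x) = g w \<longleftrightarrow> par x = w" if "x \<in> pverts G - {r}" for x
      using inj_on_eq_iff[OF g par_in[OF that] \<open>w \<in> pverts G\<close>] .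
    then show ?thesis
      unfolding H.children_def S children_def using i by auto
  qed
  have "H.weights (a \<circ> i)"
    unfolding H.weights_def
  proof
    fix w assume "w \<in> pverts H - {g r}"
    then obtain x where x: "w = g x" "x \<in> pverts G - {r}" unfolding S by blast
    have sub: "children x \<subseteq> pverts G" by (auto simp: children_def)
    have "(\<Sum>c\<in>H.children w. (a \<circ> i) c + 1) = (\<Sum>c\<in>children x. a c + 1)"
      using x ch[of x] sub i by (simp add: sum.reindex[OF inj[OF sub]] subset_iff)
    then show "(a \<circ> i) w = 1 + (\<Sum>c\<in>H.children w. (a \<circ> i) c + 1)"
      using weightsD[OF a x(2)] x i by simp
  qed
  moreover have "(\<Sum>w\<in>pverts H - {g r}. ((a \<circ> i) w)\<^sup>2) = (\<Sum>w\<in>pverts G - {r}. (a w)\<^sup>2)"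
    unfolding S using i by (subst sum.reindex[OF inj]) auto
  moreover have "card (pverts H) = card (pverts G)"
    using H card_image[OF g] by simp
  ultimately show ?thesis
    using meeting_time_eq_sum_weights[OF a] H.meeting_time_eq_sum_weights by simp
qed

lemma best_meeting_time_iso:
  assumes "undirected_tree G" and "digraph_iso (with_proj G) (with_proj H)"
  shows "best_meeting_time H = best_meeting_time G"
proof -
  have "pair_wf_digraph G"
    using assms(1) by (auto simp: undirected_tree_def pair_graph_def pair_digraph_def pair_fin_digraph_def)
  then obtain g where g: "inj_on g (pverts G)" "pverts H = g ` pverts G"
    "parcs H = map_prod g g ` parcs G"
    using assms(2) digraph_iso_with_proj_iff by metis
  have "meeting_time H (g r) = meeting_time G r" if "r \<in> pverts G" for r
    using undirected_tree_rooted[OF assms(1) that] rooted_tree.meeting_time_image[OF _ g] by metis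
  then have "meeting_time H ` pverts H = meeting_time G ` pverts G"
    unfolding g(2) by (auto simp: image_iff)
  then show ?thesis by (simp add: best_meeting_time_def)
qed

section \<open>Levers\<close>

definition lever_par :: "nat \<Rightarrow> nat \<Rightarrow> nat \<Rightarrow> nat" where
  "lever_par d k j = (if j < k then j + 1 else if j \<le> d then j - 1 else k)"

definition lever_depth :: "nat \<Rightarrow> nat \<Rightarrow> nat \<Rightarrow> nat" where
  "lever_depth d k j = (if j < k then k - j else if j \<le> d then j - k else 1)"

lemma pverts_lever: "pverts (lever n d k) = {..<n}"
  by (simp add: lever_def Let_def)

lemma parcs_lever:
  "(x, y) \<in> parcs (lever n d k) \<longleftrightarrow>
    y = x + 1 \<and> x < d \<or> x = y + 1 \<and> y < d \<or> x = k \<and> d < y \<and> y < n \<or> y = k \<and> d < x \<and> x < n"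
  by (auto simp: lever_def Let_def)

lemma rooted_tree_lever:
  assumes "k \<le> d" "d < n"
  shows "rooted_tree (lever n d k) k (lever_par d k) (lever_depth d k)"
proof
  show "parcs (lever n d k) = {(w, lever_par d k w) | w. w \<in> pverts (lever n d k) - {k}}
      \<union> {(lever_par d k w, w) | w. w \<in> pverts (lever n d k) - {k}}" (is "_ = ?A \<union> ?B")
  proof (rule antisym; rule subrelI)
    fix x y assume "(x, y) \<in> parcs (lever n d k)"
    then consider "y = lever_par d k x" "x < n" "x \<noteq> k" | "x = lever_par d k y" "y < n" "y \<noteq> k"
      using assms
      by (atomize_elim, cases "x < k"; cases "y < k") (auto simp: parcs_lever lever_par_def)
    then show "(x, y) \<in> ?A \<union> ?B" by cases (auto simp: pverts_lever)
  next
    fix x y assume "(x, y) \<in> ?A \<union> ?B"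
    then show "(x, y) \<in> parcs (lever n d k)"
      using assms by (auto simp: parcs_lever pverts_lever lever_par_def split: if_splits)
  qed
qed (use assms in \<open>auto simp: pverts_lever lever_par_def lever_depth_def\<close>)

text \<open>Twice the subtree size minus 1, for the lever rooted at its fulcrum: the subtree of
  \<open>j\<close> is the path \<open>0..j\<close> on the left arm, the path \<open>j..d\<close> on
  the right arm, and a single vertex for an extra leaf.\<close>

definition lever_weight :: "nat \<Rightarrow> nat \<Rightarrow> nat \<Rightarrow> real" where
  "lever_weight d k j = (if j < k then 2 * real j + 1 else if j \<le> d then 2 * real (d - j) + 1 else 1)"

lemma weights_lever:
  assumes "k \<le> d" "d < n"
  shows "rooted_tree.weights (lever n d k) k (lever_par d k) (lever_weight d k)"
proof -
  interpret rooted_tree "lever n d k" k "lever_par d k" "lever_depth d k"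
    by (rule rooted_tree_lever) fact+
  show ?thesis
    unfolding weights_def
  proof
    fix w assume "w \<in> pverts (lever n d k) - {k}"
    then have w: "w < n" "w \<noteq> k" by (auto simp: pverts_lever)
    consider "w = 0" "w < k" | j where "w = Suc j" "w < k" | "k < w" "w < d" | "w = d" "k < w" | "d < w"
      using w by (atomize_elim, cases w) auto
    then show "lever_weight d k w = 1 + (\<Sum>c\<in>children w. lever_weight d k c + 1)"
    proof cases
      case 1
      then have "children w = {}"
        using assms by (auto simp: children_def pverts_lever lever_par_def split: if_splits)
      then show ?thesis using 1 by (simp add: lever_weight_def)
    next
      case 2
      then have "children w = {j}"
        using assms by (auto simp: children_def pverts_lever lever_par_def split: if_splits)
      then show ?thesis using 2 by (simp add: lever_weight_def)
    next
      case 3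
      then have "children w = {Suc w}"
        using assms by (auto simp: children_def pverts_lever lever_par_def split: if_splits)
      then show ?thesis using 3 by (simp add: lever_weight_def of_nat_diff)
    next
      case 4
      then have "children w = {}"
        using assms by (auto simp: children_def pverts_lever lever_par_def split: if_splits)
      then show ?thesis using 4 by (simp add: lever_weight_def)
    next
      case 5
      then have "children w = {}"
        using assms by (auto simp: children_def pverts_lever lever_par_def split: if_splits)
      then show ?thesis using 5 assms by (simp add: lever_weight_def)
    qed
  qed
qed

lemma sum_lever_weight:
  assumes "k \<le> d" "d < n"
  shows "(\<Sum>j\<in>{..<n} - {k}. (lever_weight d k j)\<^sup>2)
    = real n - 1 + chain_excess k + chain_excess (d - k)"
proof -
  have eq: "{..<n} - {k} = {..<k} \<union> {Suc k..d} \<union> {Suc d..<n}" using assms by auto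
  have "(\<Sum>j\<in>{..<n} - {k}. (lever_weight d k j)\<^sup>2 - 1)
      = (\<Sum>j<k. (lever_weight d k j)\<^sup>2 - 1) + (\<Sum>j\<in>{Suc k..d}. (lever_weight d k j)\<^sup>2 - 1)
        + (\<Sum>j\<in>{Suc d..<n}. (lever_weight d k j)\<^sup>2 - 1)"
    unfolding eq using assms
    by (subst sum.union_disjoint, simp, simp, force, subst sum.union_disjoint) auto
  also have "(\<Sum>j<k. (lever_weight d k j)\<^sup>2 - 1) = chain_excess k"
    by (simp add: chain_excess_def lever_weight_def)
  also have "(\<Sum>j\<in>{Suc k..d}. (lever_weight d k j)\<^sup>2 - 1) = chain_excess (d - k)"
    \<comment> \<open>The right arm is counted from its far end, so index \<open>i\<close> stands
      for the vertex \<open>d - i\<close>.\<close>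
    unfolding chain_excess_def
    by (rule sum.reindex_bij_witness[of _ "\<lambda>i. d - i" "\<lambda>j. d - j"]) (auto simp: lever_weight_def)
  also have "(\<Sum>j\<in>{Suc d..<n}. (lever_weight d k j)\<^sup>2 - 1) = 0"
    using assms by (intro sum.neutral) (auto simp: lever_weight_def)
  finally have "(\<Sum>j\<in>{..<n} - {k}. (lever_weight d k j)\<^sup>2)
      = chain_excess k + chain_excess (d - k) + real (card ({..<n} - {k}))"
    by (simp add: sum_subtractf)
  then show ?thesis using assms by (simp add: of_nat_diff)
qed

lemma meeting_time_lever:
  assumes "k \<le> d" "d < n"
  shows "meeting_time (lever n d k) k
    = ennreal ((real n - 1 + chain_excess k + chain_excess (d - k)) / (2 * (real n - 1)))"
  using rooted_tree.meeting_time_eq_sum_weights[OF rooted_tree_lever[OF assms] weights_lever[OF assms]]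
  by (simp add: pverts_lever sum_lever_weight[OF assms])

section \<open>The diameter of a lever\<close>

lemma relpow_path:
  fixes R :: "nat rel"
  assumes "\<And>i. a \<le> i \<Longrightarrow> i < b \<Longrightarrow> (i, Suc i) \<in> R" and "a \<le> b"
  shows "(a, b) \<in> R ^^ (b - a)"
  using assms(2,1)
proof (induction b rule: dec_induct)
  case (step b)
  then have "(a, b) \<in> R ^^ (b - a)" "(b, Suc b) \<in> R" by auto
  then show ?case using step by (auto simp: Suc_diff_le intro: relcompI)
qed simp

text \<open>A potential that rises by at most 1 per arc bounds walk lengths from below.\<close>

lemma relpow_Lipschitz:
  fixes \<phi> :: "'a \<Rightarrow> int"
  assumes "\<And>x y. (x, y) \<in> R \<Longrightarrow> \<phi> y \<le> \<phi> x + 1" and "(x, y) \<in> R ^^ k"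
  shows "\<phi> y \<le> \<phi> x + int k"
  using assms(2)
proof (induction k arbitrary: y)
  case (Suc k)
  then obtain z where "(x, z) \<in> R ^^ k" "(z, y) \<in> R" by auto
  then show ?case using Suc.IH[of z] assms(1)[of z y] by simp
qed auto

lemma graph_diameter_lever:
  assumes "0 < k" "k < d" "d < n"
  shows "graph_diameter (lever n d k) = ereal (real d)"
proof (rule graph_diameter_eqI[of _ 0 d])
  interpret rooted_tree "lever n d k" k "lever_par d k" "lever_depth d k"
    using assms by (intro rooted_tree_lever) auto
  let ?E = "parcs (lever n d k)"
  show "pair_wf_digraph (lever n d k)" by (rule pair_wf_digraph)
  show "0 \<in> pverts (lever n d k)" "d \<in> pverts (lever n d k)" using assms by (auto simp: pverts_lever)
  show "d \<le> t" if "(0, d) \<in> ?E ^^ t" for t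
  proof -
    \<comment> \<open>The potential is the position along the path; the extra leaves get the
      position of a neighbor of the fulcrum.\<close>
    define \<phi> where "\<phi> j = (if j \<le> d then int j else int k + 1)" for j
    have "\<phi> y \<le> \<phi> x + 1" if "(x, y) \<in> ?E" for x y
      using that assms by (auto simp: parcs_lever \<phi>_def)
    from relpow_Lipschitz[of ?E \<phi>, OF this that] show ?thesis by (simp add: \<phi>_def)
  qed
  have path: "(x, y) \<in> ?E ^^ (y - x)" if "x \<le> y" "y \<le> d" for x y
    using that by (intro relpow_path) (auto simp: parcs_lever)
  have near: "\<exists>t\<le>d. (x, y) \<in> ?E ^^ t" if "x \<le> y" "y < n" for x y
  proof -
    \<comment> \<open>Routes that leave the path go through the fulcrum. Their lengths stay within
      \<open>d\<close> because the fulcrum is interior: \<open>k < d\<close> serves the left arm,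
      \<open>0 < k\<close> the right arm, and together they give \<open>2 \<le> d\<close> for two
      extra leaves.\<close>
    consider "y \<le> d" | "x \<le> k" "d < y" | "k < x" "x \<le> d" "d < y" | "d < x" "d < y"
      using that by atomize_elim linarith
    then show ?thesis
    proof cases
      case 1
      then show ?thesis using path[of x y] that by (intro exI[of _ "y - x"]) auto
    next
      case 2
      have "(x, y) \<in> ?E ^^ Suc (k - x)"
        using path[of x k] 2 that assms by (auto simp: parcs_lever intro!: relcompI)
      then show ?thesis using assms by (intro exI[of _ "Suc (k - x)"]) auto
    next
      case 3
      have "(x, k) \<in> ?E ^^ (x - k)" using path[of k x] 3 relpow_symmetric by simp
      then have "(x, y) \<in> ?E ^^ Suc (x - k)"
        using 3 that by (auto simp: parcs_lever intro!: relcompI)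
      then show ?thesis using 3 assms by (intro exI[of _ "Suc (x - k)"]) auto
    next
      case 4
      then have "(x, k) \<in> ?E" "(k, y) \<in> ?E" using that by (auto simp: parcs_lever)
      then have "(x, y) \<in> ?E ^^ 2" by (auto simp: numeral_2_eq_2)
      then show ?thesis using assms by (intro exI[of _ 2]) auto
    qed
  qed
  show "\<exists>t\<le>d. (x, y) \<in> ?E ^^ t" if "x \<in> pverts (lever n d k)" "y \<in> pverts (lever n d k)" for x y
    using near[of x y] near[of y x] that relpow_symmetric[of y x]
    by (cases "x \<le> y") (auto simp: pverts_lever)
qed

text \<open>The lever is laid onto the tree: up the branch of \<open>u\<close>, through
  \<open>r\<close>, down the branch of \<open>v\<close>. The \<open>n - 1 - d\<close> remaining
  vertices all hang from \<open>r\<close>, so any bijection with the extra leaves will do.\<close>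

lemma (in forked_tree) lever_shape:
  assumes top: "(par ^^ k) u = r"
    and off: "\<And>w. w \<in> pverts G - {r} - (branch \<union> forked_tree.branch par v l) \<Longrightarrow> par w = r"
    and d: "d = k + l" and n: "n = card (pverts G)"
  shows "d < n"
    and "\<exists>f. inj_on f {..<n} \<and> pverts G = f ` {..<n} \<and> parcs G = map_prod f f ` parcs (lever n d k)"
proof -
  interpret S: forked_tree G r par depth v u l k by (rule swap)
  let ?R = "pverts G - {r} - (branch \<union> S.branch)"
  have "card (branch \<union> S.branch) = k + l"
    using branches_disjoint card_branch S.card_branch
    by (subst card_Un_disjoint) (auto simp: branch_def S.branch_def)
  moreover have "branch \<union> S.branch \<subseteq> pverts G - {r}"
    using branch_subset S.branch_subset by auto
  ultimately have "card ?R = n - 1 - d" and "d \<le> n - 1"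
    using finite_verts root_in card_mono[of "pverts G - {r}" "branch \<union> S.branch"]
    by (auto simp: card_Diff_subset finite_subset n d)
  moreover have "0 < n" using finite_verts root_in by (auto simp: n card_gt_0_iff)
  ultimately have "d < n" and "card {Suc d..<n} = card ?R" by auto
  then obtain e where e: "bij_betw e {Suc d..<n} ?R"
    using finite_same_card_bij[of "{Suc d..<n}" ?R] finite_verts by auto
  show "d < n" by fact
  define f where "f i = (if i \<le> k then (par ^^ i) u else if i \<le> d then (par ^^ (d - i)) v else e i)" for i
  have fk: "f k = r" using top by (simp add: f_def)
  \<comment> \<open>At \<open>i = k\<close> the two formulas agree, by \<open>meet\<close> and
    \<open>d - k = l\<close>; the right arm can thus be treated together with the fulcrum.\<close>
  have f_v: "f i = (par ^^ (d - i)) v" if "k \<le> i" "i \<le> d" for i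
    using that meet d by (auto simp: f_def)
  have "f ` {..<n} = pverts G"
  proof (rule antisym; rule subsetI)
    fix w assume "w \<in> f ` {..<n}"
    then obtain i where i: "w = f i" "i < n" by auto
    consider "i \<le> k" | "k < i" "i \<le> d" | "d < i" by linarith
    then show "w \<in> pverts G"
    proof cases
      case 1
      then show ?thesis using i par_funpow(1)[OF u_in, of i] k_le by (simp add: f_def)
    next
      case 2
      then show ?thesis using i par_funpow(1)[OF v_in, of "d - i"] l_le d by (simp add: f_def)
    next
      case 3
      then show ?thesis using i bij_betwE[OF e] d by (auto simp: f_def)
    qed
  next
    fix w assume "w \<in> pverts G"
    then consider "w = r" | "w \<in> branch" | "w \<in> S.branch" | "w \<in> ?R" by blast
    then show "w \<in> f ` {..<n}"
    proof cases
      case 1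
      then show ?thesis using fk \<open>d < n\<close> d by (intro image_eqI[of _ _ k]) auto
    next
      case 2
      then obtain i where "i < k" "w = (par ^^ i) u" by (auto simp: branch_def)
      then show ?thesis using \<open>d < n\<close> d by (intro image_eqI[of _ _ i]) (auto simp: f_def)
    next
      case 3
      then obtain j where "j < l" "w = (par ^^ j) v" by (auto simp: S.branch_def)
      then show ?thesis
        using \<open>d < n\<close> d f_v[of "d - j"] by (intro image_eqI[of _ _ "d - j"]) auto
    next
      case 4
      then obtain i where "i \<in> {Suc d..<n}" "w = e i"
        using bij_betw_imp_surj_on[OF e] by blast
      then show ?thesis using d by (intro image_eqI[of _ _ i]) (auto simp: f_def)
    qed
  qed
  \<comment> \<open>A surjection between finite sets of equal size is injective.\<close>
  moreover from this have "inj_on f {..<n}"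
    by (intro eq_card_imp_inj_on) (simp_all add: n)
  moreover have "parcs G = map_prod f f ` parcs (lever n d k)"
  proof (rule rooted_tree.arcs_eq_image[OF rooted_tree_lever])
    show "rooted_tree G (f k) par depth" unfolding fk by unfold_locales
    fix j assume "j \<in> pverts (lever n d k) - {k}"
    then have j: "j < n" "j \<noteq> k" by (auto simp: pverts_lever)
    then consider "j < k" | "k < j" "j \<le> d" | "d < j" by linarith
    then show "par (f j) = f (lever_par d k j)"
    proof cases
      case 1
      then show ?thesis by (simp add: f_def lever_par_def)
    next
      case 2
      then have "d - (j - 1) = Suc (d - j)" by simp
      then show ?thesis using 2 f_v[of j] f_v[of "j - 1"] by (simp add: lever_par_def)
    next
      case 3
      then have "e j \<in> ?R" using bij_betwE[OF e] j by auto
      then show ?thesis using 3 off d fk by (simp add: f_def lever_par_def)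
    qed
  qed (use \<open>d < n\<close> d calculation in \<open>auto simp: pverts_lever\<close>)
  ultimately show "\<exists>f. inj_on f {..<n} \<and> pverts G = f ` {..<n}
      \<and> parcs G = map_prod f f ` parcs (lever n d k)" by metis
qed

text \<open>The bound and its equality case hold for every single target \<open>r\<close>;
  minimizing over targets then needs only that the minimum is attained.\<close>

lemma tree_meeting_time_ge:
  assumes G: "undirected_tree G" "card (pverts G) = n" "graph_diameter G = ereal (real d)"
    and d: "2 \<le> d" and r: "r \<in> pverts G"
  defines "m \<equiv> d div 2"
  defines "val \<equiv> (real n - 1 + chain_excess m + chain_excess (d - m)) / (2 * (real n - 1))"
  shows "ennreal val \<le> meeting_time G r"
    and "meeting_time G r = ennreal val \<Longrightarrow> digraph_iso (with_proj G) (with_proj (lever n d m))"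
proof -
  have pg: "pair_graph G" using G(1) by (simp add: undirected_tree_def)
  then have wf: "pair_wf_digraph G"
    by (simp add: pair_graph_def pair_digraph_def pair_fin_digraph_def)
  obtain par depth where "rooted_tree G r par depth" using undirected_tree_rooted[OF G(1) r] .
  then interpret rooted_tree G r par depth .
  obtain u v where uv: "u \<in> pverts G" "v \<in> pverts G" "\<And>k. (u, v) \<in> parcs G ^^ k \<Longrightarrow> d \<le> k"
    using far_pair_of_graph_diameter[OF wf G(3)] d by auto
  obtain k l where F: "forked_tree G r par depth u v k l" and kl: "d \<le> k + l"
    using forked_tree_of_far_pair[OF uv] by blast
  obtain a where a: "weights a" using weights_hitting_time by blast
  have n: "0 < n" using finite_verts r G(2) by (auto simp: card_gt_0_iff)
  define D where "D = (\<Sum>w\<in>pverts G - {r}. (a w)\<^sup>2 - 1)"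
  have "(\<Sum>w\<in>pverts G - {r}. (a w)\<^sup>2) = D + (real n - 1)"
    using r G(2) n by (simp add: D_def sum_subtractf of_nat_diff)
  then have mt: "meeting_time G r = ennreal ((D + (real n - 1)) / (2 * (real n - 1)))"
    using meeting_time_eq_sum_weights[OF a] G(2) by simp
  have D: "chain_excess k + chain_excess l \<le> D"
    unfolding D_def by (rule forked_tree.excess_le_sum_weights[OF F a])
  have bal: "chain_excess m + chain_excess (d - m) \<le> chain_excess k + chain_excess l"
    unfolding m_def by (rule chain_excess_balanced(1)[OF kl])
  show "ennreal val \<le> meeting_time G r"
    unfolding mt val_def using D bal n
    by (intro ennreal_leI divide_right_mono) auto
  assume eq: "meeting_time G r = ennreal val"
  have excess_nonneg: "0 \<le> chain_excess j" for j
    unfolding chain_excess_def by (intro sum_nonneg) (simp add: one_le_power)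
  have "u \<noteq> v" using uv(3)[of 0] d by auto
  then have "{u, v} \<subseteq> pverts G" "card {u, v} = 2" using uv by auto
  then have "1 < n" using card_mono[OF finite_verts, of "{u, v}"] G(2) by simp
  \<comment> \<open>Injectivity of \<open>ennreal\<close> needs both sides nonnegative;
    \<open>1 < n\<close> keeps the denominator away from 0 when it is cancelled.\<close>
  have "(D + (real n - 1)) / (2 * (real n - 1)) = val"
    using eq D excess_nonneg \<open>1 < n\<close> unfolding mt val_def
    by (subst (asm) ennreal_inj) (auto intro!: divide_nonneg_nonneg add_nonneg_nonneg order_trans[OF _ D])
  then have "D = chain_excess m + chain_excess (d - m)"
    using \<open>1 < n\<close> by (simp add: val_def divide_simps)
  then have tight: "D = chain_excess k + chain_excess l"
    and ckl: "chain_excess k + chain_excess l = chain_excess m + chain_excess (d - m)"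
    using D bal by simp_all
  \<comment> \<open>Stated for arbitrary \<open>u\<close> and \<open>v\<close>, since the shorter
    arm may belong to either end of the diametral path; the second case below exchanges
    them.\<close>
  have shape: "d < n \<and> (\<exists>f. inj_on f {..<n} \<and> pverts G = f ` {..<n} \<and> parcs G = map_prod f f ` parcs (lever n d m))"
    if F: "forked_tree G r par depth u v m (d - m)"
      and tight: "D = chain_excess m + chain_excess (d - m)" for u v
  proof -
    interpret forked_tree G r par depth u v m "d - m" by fact
    show ?thesis
      using lever_shape[OF tight_top[OF a tight[unfolded D_def]] tight_off_branches[OF a tight[unfolded D_def]], of d n]
        d G(2) by (simp add: m_def)
  qed
  have "d < n \<and> (\<exists>f. inj_on f {..<n} \<and> pverts G = f ` {..<n} \<and> parcs G = map_prod f f ` parcs (lever n d m))"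
    using chain_excess_balanced(2)[OF kl d ckl[unfolded m_def]]
  proof (elim disjE conjE)
    assume "k = d div 2" "l = d - d div 2"
    then show ?thesis using shape[of u v] F tight by (simp add: m_def)
  next
    assume "l = d div 2" "k = d - d div 2"
    then show ?thesis using shape[of v u] forked_tree.swap[OF F] tight by (simp add: m_def)
  qed
  then obtain f where "d < n" and f: "inj_on f {..<n}" "pverts G = f ` {..<n}"
    "parcs G = map_prod f f ` parcs (lever n d m)" by blast
  \<comment> \<open>\<open>f\<close> maps the lever onto \<open>G\<close>; the isomorphism is wanted
    in the opposite direction.\<close>
  define g where "g = the_inv_into {..<n} f"
  have gf: "g (f i) = i" if "i < n" for i using the_inv_into_f_f[OF f(1)] that by (simp add: g_def)
  have "parcs (lever n d m) = map_prod g g ` parcs G"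
  proof -
    have "x < n \<and> y < n" if "(x, y) \<in> parcs (lever n d m)" for x y
      using that \<open>d < n\<close> by (auto simp: parcs_lever m_def)
    then have "map_prod g g ` map_prod f f ` parcs (lever n d m) = id ` parcs (lever n d m)"
      unfolding image_image by (intro image_cong) (auto simp: gf)
    then show ?thesis by (simp add: f(3))
  qed
  moreover have "g ` pverts G = {..<n}" unfolding f(2) image_image by (simp add: gf)
  moreover have "inj_on g (pverts G)" unfolding f(2) by (rule inj_onI) (auto simp: gf)
  ultimately show "digraph_iso (with_proj G) (with_proj (lever n d m))"
    unfolding digraph_iso_with_proj_iff[OF wf] pverts_lever by (intro exI[of _ g]) simp
qed

lemma best_meeting_time_ge:
  assumes "undirected_tree G" "card (pverts G) = n" "graph_diameter G = ereal (real d)" "2 \<le> d"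
  defines "val \<equiv> (real n - 1 + chain_excess (d div 2) + chain_excess (d - d div 2)) / (2 * (real n - 1))"
  shows "ennreal val \<le> best_meeting_time G"
    and "best_meeting_time G = ennreal val
      \<Longrightarrow> digraph_iso (with_proj G) (with_proj (balanced_lever n d))"
proof -
  interpret G: pair_graph G using assms(1) by (simp add: undirected_tree_def)
  have "pverts G \<noteq> {}"
    using assms(1) by (auto simp: undirected_tree_def connected_def strongly_connected_def mk_symmetric_def)
  then have "best_meeting_time G \<in> meeting_time G ` pverts G"
    unfolding best_meeting_time_def using G.pair_finite_verts by (intro Min_in) auto
  then obtain r where "r \<in> pverts G" "best_meeting_time G = meeting_time G r" by blast
  then show "ennreal val \<le> best_meeting_time G"
    and "best_meeting_time G = ennreal val
      \<Longrightarrow> digraph_iso (with_proj G) (with_proj (balanced_lever n d))"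
    using tree_meeting_time_ge[OF assms(1-4)] unfolding val_def balanced_lever_def by metis+
qed

theorem theorem1p6:
  fixes n d :: nat
  assumes "2 \<le> d" and "d \<le> n - 1"
  shows
    "undirected_tree (balanced_lever n d) \<and> card (pverts (balanced_lever n d)) = n \<and>
       graph_diameter (balanced_lever n d) = ereal (real d) \<and>
     (\<forall>G :: 'a pair_pre_digraph.
        undirected_tree G \<and> card (pverts G) = n \<and> graph_diameter G = ereal (real d) \<longrightarrow>
          best_meeting_time (balanced_lever n d) \<le> best_meeting_time G \<and>
          (best_meeting_time G = best_meeting_time (balanced_lever n d) \<longleftrightarrow>
             digraph_iso (with_proj G) (with_proj (balanced_lever n d)))) \<and>
     best_meeting_time (balanced_lever n d) =
       ennreal (if odd d then (real d ^ 3 - real d) / (6 * (real n - 1)) + 1 / 2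
                else (real d ^ 3 - 4 * real d) / (6 * (real n - 1)) + 1 / 2)"
proof -
  define m where "m = d div 2"
  define val where "val = (real n - 1 + chain_excess m + chain_excess (d - m)) / (2 * (real n - 1))"
  have m: "0 < m" "m < d" "d < n" using assms by (auto simp: m_def)
  have tree: "undirected_tree (balanced_lever n d)"
    unfolding balanced_lever_def m_def[symmetric]
    by (rule rooted_tree.undirected_tree[OF rooted_tree_lever]) (use m in auto)
  have card: "card (pverts (balanced_lever n d)) = n"
    by (simp add: balanced_lever_def pverts_lever)
  have diam: "graph_diameter (balanced_lever n d) = ereal (real d)"
    unfolding balanced_lever_def m_def[symmetric] by (rule graph_diameter_lever) fact+
  \<comment> \<open>The fulcrum gives the upper bound; the general lower bound, applied to the
    balanced lever itself, gives the converse.\<close>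
  have "best_meeting_time (balanced_lever n d) \<le> meeting_time (balanced_lever n d) m"
    unfolding best_meeting_time_def
    using m by (intro Min_le) (auto simp: balanced_lever_def pverts_lever)
  also have "\<dots> = ennreal val"
    unfolding balanced_lever_def m_def[symmetric] val_def using m by (intro meeting_time_lever) auto
  finally have best: "best_meeting_time (balanced_lever n d) = ennreal val"
    using best_meeting_time_ge(1)[OF tree card diam assms(1)]
    by (simp add: val_def m_def antisym)
  have formula: "val = (if odd d then (real d ^ 3 - real d) / (6 * (real n - 1)) + 1 / 2
                else (real d ^ 3 - 4 * real d) / (6 * (real n - 1)) + 1 / 2)"
  proof -
    have N: "0 < real n - 1" using m by simp
    \<comment> \<open>The factor 3 clears the denominator of \<open>chain_excess_closed\<close>.
      With \<open>m = d div 2\<close>, the arms are \<open>m\<close> and \<open>m + 1\<close> for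
      odd \<open>d\<close> and both \<open>m\<close> for even \<open>d\<close>.\<close>
    have excess: "3 * (chain_excess m + chain_excess (d - m))
        = (if odd d then real d ^ 3 - real d else real d ^ 3 - 4 * real d)"
    proof (cases "odd d")
      case True
      then have "d = Suc (2 * m)" "d - m = Suc m" by (auto simp: m_def elim: oddE)
      then have "real d = 2 * real m + 1" "real (d - m) = real m + 1" by simp_all
      then show ?thesis using True
        by (simp only: chain_excess_closed) (simp add: power3_eq_cube field_simps)
    next
      case False
      then have "d = 2 * m" "d - m = m" by (auto simp: m_def)
      then have "real d = 2 * real m" "real (d - m) = real m" by simp_all
      then show ?thesis using False
        by (simp only: chain_excess_closed) (simp add: power3_eq_cube field_simps)
    qed
    have "val = 3 * (chain_excess m + chain_excess (d - m)) / (6 * (real n - 1)) + 1 / 2"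
      using N by (simp add: val_def field_simps)
    then show ?thesis unfolding excess by simp
  qed
  \<comment> \<open>Equality implies isomorphism by the equality case of the bound; the converse is
    invariance of the best meeting time under isomorphism.\<close>
  have "best_meeting_time (balanced_lever n d) \<le> best_meeting_time G \<and>
      (best_meeting_time G = best_meeting_time (balanced_lever n d) \<longleftrightarrow>
         digraph_iso (with_proj G) (with_proj (balanced_lever n d)))"
    if "undirected_tree G" "card (pverts G) = n" "graph_diameter G = ereal (real d)"
    for G :: "'a pair_pre_digraph"
    using best_meeting_time_ge[OF that assms(1)] best_meeting_time_iso[OF that(1)] best
    by (metis m_def val_def)
  then show ?thesis
    using tree card diam best formula by simp
qed

end
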